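(* Let $\Omega,\mathcal T_h,\mathcal T_{h,I},\Omega_h$, the spaces $W_h,V_h,W_{h,I},V_{h,I},W_h^E,V_h^E$ and the operators $A_h,F_h,E_h$ be as described in the context, and assume that A1–A4 hold. For each $v\in H^s(\Omega_h)$, $0\le s\le k+1$, there is $v_\star^E\in V_h^E$ such that $$\|v-v_\star^E\|_{H^m(\Omega_h)}\lesssim h^{s-m}|v|_{H^s(\Omega_h)},\qquad 0\le m\le l,\ m\le s,$$ where the hidden constant is independent of $v\in H^s(\Omega_h)$, of the intersection of $\partial\Omega$ with the elements, and of the mesh size $h$.
   Context: Setting. $\Omega\subset\mathbb R^d$ is a domain with boundary $\partial\Omega$, and $\widetilde\Omega\supset\Omega$ is a polygonal domain. $\widetilde{\mathcal T}_h$, $h\in(0,h_0]$, is a quasiuniform family of meshes of $\widetilde\Omega$ with mesh parameter $h$. The active mesh is $\mathcal T_h=\{T\in\widetilde{\mathcal T}_h: T\cap\Omega\ne\emptyset\}$ and $\Omega_h=\bigcup_{T\in\mathcal T_h}T$. Set $\mathcal T_{h,I}=\{T\in\mathcal T_h: T\subset\Omega\}$ and $\mathcal T_{h,B}=\mathcal T_h\setminus\mathcal T_{h,I}$. Spaces. $W_h=\bigoplus_{T\in\mathcal T_h}\mathbb P_k(T)$ (discontinuous piecewise polynomials of order $k$), and $V_h$ (the active finite element space) is a subspace of $W_h\cap H^l(\Omega_h)$, $l\in\mathbb N$. $W_{h,I}=W_h|_{\mathcal T_{h,I}}$, $V_{h,I}=V_h|_{\mathcal T_{h,I}}$, and $(w)_I=w|_{\mathcal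 T_{h,I}}$ is the restriction of $w\in W_h$. Operators. $A_h:W_h\to V_h$ (average operator) and $F_h:W_{h,I}\to W_h$ (extension operator) are linear; $W_h^E=F_h(W_{h,I})\subset W_h$. The discrete extension operator is $E_h:V_{h,I}\ni v\mapsto A_hF_hv\in V_h$, and $V_h^E=E_hV_{h,I}\subset V_h$ is its image. Norms. $\nabla^j v$ is the tensor of all $j$-th order partial derivatives (taken elementwise for functions in $W_h$), $\|\cdot\|_\omega=\|\cdot\|_{L^2(\omega)}$, $\|v\|^2_{\mathcal T_h}=\sum_{T\in\mathcal T_h}\|v\|_T^2$ (similarly for $\mathcal T_{h,I}$), $\|v\|_{H^m(\mathcal T_h)}^2=\sum_{j=0}^m\|\nabla^jv\|_{\mathcal T_h}^2$, and $|\cdot|_{H^s}$ is the Sobolev seminorm. $a\lesssim b$ means $a\le Cb$ with $C$ independent of the mesh parameter $h$, of the functions involved, and of how $\partial\Omega$ intersects the mesh. Assumptions. A1: $\|w\|_{H^m(\mathcal T_h)}\lesssim h^{-m}\|w\|_{\mathcal T_h}$ for all $w\in W_h$. A2: for $v\in H^s(\Omega_h)$, $0\le s\le k+1$, there are $v_\star\in V_h$ and $w_\star\in W_h^E$ with $\|v-v_\star\|_{H^m(\Omega_h)}\lesssim h^{s-m}|v|_{H^s(\Omega_h)}$ and $\|v-w_\star\|_{H^m(\mathcal T_h)}\lesssim h^{s-m}|v|_{H^s(\Omega_h)}$, for integers $0\le m\le\min(l,s)$. A3: $A_h$ is linear, $\|A_hv\|_{\mathcal T_h}\lesssim\|v\|_{\mathcal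 T_h}$ for $v\in W_h$, and $A_hv=v$ for $v\in V_h$. A4: $F_h$ is linear, $\|\nabla^jF_hw\|_{\mathcal T_h}\lesssim\|\nabla^jw\|_{\mathcal T_{h,I}}$ for $w\in W_{h,I}$, $0\le j\le l$, and $F_h(w)_I=w$ for $w\in W_h^E$. *)

theory Defs
  imports "HOL-Analysis.Analysis"
begin

section \<open>Sobolev spaces on open subsets of Euclidean space\<close>

definition L2 :: "(real^'n) set \<Rightarrow> (real^'n \<Rightarrow> real) set" where
  "L2 S = {u. set_borel_measurable lebesgue S u \<and> set_integrable lebesgue S (\<lambda>x. (u x)\<^sup>2)}"

definition L2_norm_on :: "(real^'n) set \<Rightarrow> (real^'n \<Rightarrow> real) \<Rightarrow> real" where
  "L2_norm_on S u = sqrt (set_lebesgue_integral lebesgue S (\<lambda>x. (u x)\<^sup>2))"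

text \<open>A list \<open>[i\<^sub>1, \<dots>, i\<^sub>j]\<close> of coordinate indices stands for the partial derivative
  \<open>\<partial>\<^sub>i\<^sub>1 \<dots> \<partial>\<^sub>i\<^sub>j\<close>. Thus the entries of the tensor \<open>\<nabla>\<^sup>j u\<close> are indexed by the lists of length \<open>j\<close>,
  and sums over these lists give the Frobenius norm of the tensor.\<close>

primrec iter_partial :: "'n list \<Rightarrow> (real^'n \<Rightarrow> real) \<Rightarrow> real^'n \<Rightarrow> real" where
  "iter_partial [] f = f"
| "iter_partial (i # is) f =
     (\<lambda>x. frechet_derivative (iter_partial is f) (at x) (axis i 1))"

text \<open>All iterated partial derivatives exist and are differentiable (hence continuous),
  i.e. the function is of class \<open>C\<^sup>\<infinity>\<close>.\<close>

definition smooth_fun :: "(real^'n \<Rightarrow> real) \<Rightarrow> bool" where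
  "smooth_fun f \<longleftrightarrow> (\<forall>is x. iter_partial is f differentiable (at x))"

definition test_fun :: "(real^'n) set \<Rightarrow> (real^'n \<Rightarrow> real) \<Rightarrow> bool" where
  "test_fun S \<phi> \<longleftrightarrow> smooth_fun \<phi> \<and>
     compact (closure {x. \<phi> x \<noteq> 0}) \<and> closure {x. \<phi> x \<noteq> 0} \<subseteq> S"

definition is_weak_deriv ::
    "(real^'n) set \<Rightarrow> 'n list \<Rightarrow> (real^'n \<Rightarrow> real) \<Rightarrow> (real^'n \<Rightarrow> real) \<Rightarrow> bool" where
  "is_weak_deriv S is u g \<longleftrightarrow>
     (\<forall>\<phi>. test_fun S \<phi> \<longrightarrow>
        set_lebesgue_integral lebesgue S (\<lambda>x. u x * iter_partial is \<phi> x) =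
        (-1) ^ length is * set_lebesgue_integral lebesgue S (\<lambda>x. g x * \<phi> x))"

text \<open>The weak derivative is determined only up to null sets, so some representative is chosen.\<close>

definition weak_deriv ::
    "(real^'n) set \<Rightarrow> 'n list \<Rightarrow> (real^'n \<Rightarrow> real) \<Rightarrow> real^'n \<Rightarrow> real" where
  "weak_deriv S is u = (SOME g. g \<in> L2 S \<and> is_weak_deriv S is u g)"

definition sobolev :: "nat \<Rightarrow> (real^'n) set \<Rightarrow> (real^'n \<Rightarrow> real) set" where
  "sobolev m S =
     {u \<in> L2 S. \<forall>is. length is \<le> m \<longrightarrow> (\<exists>g\<in>L2 S. is_weak_deriv S is u g)}"

text \<open>The norm of \<open>\<nabla>\<^sup>j u\<close> in \<open>L\<^sup>2(S)\<close>.\<close>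

definition grad_norm :: "nat \<Rightarrow> (real^'n) set \<Rightarrow> (real^'n \<Rightarrow> real) \<Rightarrow> real" where
  "grad_norm j S u =
     sqrt (\<Sum>is | length is = j. (L2_norm_on S (weak_deriv S is u))\<^sup>2)"

definition sobolev_norm :: "nat \<Rightarrow> (real^'n) set \<Rightarrow> (real^'n \<Rightarrow> real) \<Rightarrow> real" where
  "sobolev_norm m S u = sqrt (\<Sum>j\<le>m. (grad_norm j S u)\<^sup>2)"

text \<open>Real orders \<open>s \<ge> 0\<close>: for integer \<open>s\<close> these are the notions above, for non-integer \<open>s\<close>
  the Sobolev--Slobodeckij space and seminorm. The quotient is 0 on the diagonal, a null set.\<close>

definition slobodeckij_quot ::
    "real \<Rightarrow> (real^'n \<Rightarrow> real) \<Rightarrow> (real^'n) \<times> (real^'n) \<Rightarrow> real" where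
  "slobodeckij_quot \<sigma> g =
     (\<lambda>(x, y). (g x - g y)\<^sup>2 / norm (x - y) powr (real CARD('n) + 2 * \<sigma>))"

definition sobolev_real :: "real \<Rightarrow> (real^'n) set \<Rightarrow> (real^'n \<Rightarrow> real) set" where
  "sobolev_real s S =
     {u \<in> sobolev (nat \<lfloor>s\<rfloor>) S. frac s \<noteq> 0 \<longrightarrow>
        (\<forall>is. length is = nat \<lfloor>s\<rfloor> \<longrightarrow>
           set_integrable lebesgue (S \<times> S) (slobodeckij_quot (frac s) (weak_deriv S is u)))}"

definition sobolev_real_seminorm :: "real \<Rightarrow> (real^'n) set \<Rightarrow> (real^'n \<Rightarrow> real) \<Rightarrow> real" where
  "sobolev_real_seminorm s S u =
     (if frac s = 0 then grad_norm (nat \<lfloor>s\<rfloor>) S u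
      else sqrt (\<Sum>is | length is = nat \<lfloor>s\<rfloor>.
             set_lebesgue_integral lebesgue (S \<times> S)
               (slobodeckij_quot (frac s) (weak_deriv S is u))))"


section \<open>Meshes and piecewise polynomials\<close>

definition is_domain :: "(real^'n) set \<Rightarrow> bool" where
  "is_domain S \<longleftrightarrow> open S \<and> connected S \<and> S \<noteq> {}"

definition polygonal_domain :: "(real^'n) set \<Rightarrow> bool" where
  "polygonal_domain S \<longleftrightarrow> is_domain S \<and> bounded S \<and>
     (\<exists>P. finite P \<and> (\<forall>F\<in>P. polytope F) \<and> frontier S = \<Union>P)"

text \<open>Elements are closed. They need not be simplices, and hanging nodes are allowed.\<close>

definition is_mesh :: "(real^'n) set set \<Rightarrow> (real^'n) set \<Rightarrow> bool" where
  "is_mesh M S \<longleftrightarrow> finite M \<and> (\<forall>T\<in>M. polytope T \<and> interior T \<noteq> {}) \<and>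
     pairwise (\<lambda>T T'. interior T \<inter> interior T' = {}) M \<and> \<Union>M = closure S"

definition poly_fun :: "nat \<Rightarrow> (real^'n \<Rightarrow> real) \<Rightarrow> bool" where
  "poly_fun k p \<longleftrightarrow>
     (\<exists>c. \<forall>x. p x = (\<Sum>\<alpha> | sum \<alpha> UNIV \<le> k. c \<alpha> * (\<Prod>i\<in>UNIV. (x $ i) ^ \<alpha> i)))"

text \<open>A piecewise polynomial is represented by the function that is the given polynomial in the
  interior of each element and 0 elsewhere. As the element boundaries are null sets and the
  interiors are non-empty, this is a faithful model of the direct sum of the spaces \<open>\<bbbP>\<^sub>k(T)\<close>,
  in which equality of functions is equality in the direct sum.\<close>

definition broken_poly :: "nat \<Rightarrow> (real^'n) set set \<Rightarrow> (real^'n \<Rightarrow> real) set" where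
  "broken_poly k M =
     {w. (\<forall>T\<in>M. \<exists>p. poly_fun k p \<and> (\<forall>x\<in>interior T. w x = p x)) \<and>
         (\<forall>x. x \<notin> (\<Union>T\<in>M. interior T) \<longrightarrow> w x = 0)}"

definition mesh_restrict :: "(real^'n) set set \<Rightarrow> (real^'n \<Rightarrow> real) \<Rightarrow> real^'n \<Rightarrow> real" where
  "mesh_restrict M w = (\<lambda>x. if x \<in> (\<Union>T\<in>M. interior T) then w x else 0)"

definition broken_L2_norm :: "(real^'n) set set \<Rightarrow> (real^'n \<Rightarrow> real) \<Rightarrow> real" where
  "broken_L2_norm M v = sqrt (\<Sum>T\<in>M. (L2_norm_on T v)\<^sup>2)"

text \<open>Derivatives are taken elementwise, in the (open) interior of each element.\<close>

definition broken_grad_norm :: "nat \<Rightarrow> (real^'n) set set \<Rightarrow> (real^'n \<Rightarrow> real) \<Rightarrow> real" where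
  "broken_grad_norm j M v = sqrt (\<Sum>T\<in>M. (grad_norm j (interior T) v)\<^sup>2)"

definition broken_sobolev_norm :: "nat \<Rightarrow> (real^'n) set set \<Rightarrow> (real^'n \<Rightarrow> real) \<Rightarrow> real" where
  "broken_sobolev_norm m M v = sqrt (\<Sum>j\<le>m. (broken_grad_norm j M v)\<^sup>2)"

definition fun_subspace :: "('a \<Rightarrow> real) set \<Rightarrow> bool" where
  "fun_subspace V \<longleftrightarrow> (\<lambda>x. 0) \<in> V \<and>
     (\<forall>u\<in>V. \<forall>v\<in>V. (\<lambda>x. u x + v x) \<in> V) \<and> (\<forall>a. \<forall>u\<in>V. (\<lambda>x. a * u x) \<in> V)"

definition linear_map_between ::
    "('a \<Rightarrow> real) set \<Rightarrow> ('a \<Rightarrow> real) set \<Rightarrow> (('a \<Rightarrow> real) \<Rightarrow> 'a \<Rightarrow> real) \<Rightarrow> bool" where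
  "linear_map_between U V L \<longleftrightarrow> L \<in> U \<rightarrow> V \<and>
     (\<forall>u\<in>U. \<forall>v\<in>U. L (\<lambda>x. u x + v x) = (\<lambda>x. L u x + L v x)) \<and>
     (\<forall>a. \<forall>u\<in>U. L (\<lambda>x. a * u x) = (\<lambda>x. a * L u x))"


section \<open>Cut finite element configurations\<close>

text \<open>One configuration consists of the domain \<open>\<Omega>\<close>, the surrounding polygonal domain, a mesh of the
  latter with its mesh parameter \<open>h\<close>, the active finite element space \<open>V\<^sub>h\<close> and the average and
  extension operators \<open>A\<^sub>h\<close> and \<open>F\<^sub>h\<close>. A bound \<open>a \<lesssim> b\<close> is understood over a family of configurations:
  one constant serves all of them. The family may contain several configurations with
  the same \<open>h\<close> but different positions of \<open>\<Omega>\<close> relative to the mesh, so such a constant is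
  independent of both \<open>h\<close> and the way in which the boundary of \<open>\<Omega>\<close> cuts the mesh.\<close>

record 'n cutfem =
  cut_dom :: "(real^'n) set"
  bg_dom :: "(real^'n) set"
  bg_mesh :: "(real^'n) set set"
  hpar :: real
  Vh :: "(real^'n \<Rightarrow> real) set"
  Ah :: "(real^'n \<Rightarrow> real) \<Rightarrow> real^'n \<Rightarrow> real"
  Fh :: "(real^'n \<Rightarrow> real) \<Rightarrow> real^'n \<Rightarrow> real"

definition active_mesh :: "'n::finite cutfem \<Rightarrow> (real^'n) set set" where
  "active_mesh c = {T \<in> bg_mesh c. T \<inter> cut_dom c \<noteq> {}}"

definition interior_mesh :: "'n::finite cutfem \<Rightarrow> (real^'n) set set" where
  "interior_mesh c = {T \<in> active_mesh c. T \<subseteq> cut_dom c}"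

text \<open>The union of the closed active elements, made open so that weak derivatives make sense.\<close>

definition active_dom :: "'n::finite cutfem \<Rightarrow> (real^'n) set" where
  "active_dom c = interior (\<Union>(active_mesh c))"

definition Wh :: "nat \<Rightarrow> 'n::finite cutfem \<Rightarrow> (real^'n \<Rightarrow> real) set" where
  "Wh k c = broken_poly k (active_mesh c)"

definition restr_I :: "'n::finite cutfem \<Rightarrow> (real^'n \<Rightarrow> real) \<Rightarrow> real^'n \<Rightarrow> real" where
  "restr_I c = mesh_restrict (interior_mesh c)"

definition WhI :: "nat \<Rightarrow> 'n::finite cutfem \<Rightarrow> (real^'n \<Rightarrow> real) set" where
  "WhI k c = restr_I c ` Wh k c"

definition VhI :: "'n::finite cutfem \<Rightarrow> (real^'n \<Rightarrow> real) set" where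
  "VhI c = restr_I c ` Vh c"

definition WhE :: "nat \<Rightarrow> 'n::finite cutfem \<Rightarrow> (real^'n \<Rightarrow> real) set" where
  "WhE k c = Fh c ` WhI k c"

definition Eh :: "'n::finite cutfem \<Rightarrow> (real^'n \<Rightarrow> real) \<Rightarrow> real^'n \<Rightarrow> real" where
  "Eh c v = Ah c (Fh c v)"

definition VhE :: "'n::finite cutfem \<Rightarrow> (real^'n \<Rightarrow> real) set" where
  "VhE c = Eh c ` VhI c"

definition cutfem_setting :: "nat \<Rightarrow> nat \<Rightarrow> 'n::finite cutfem \<Rightarrow> bool" where
  "cutfem_setting k l c \<longleftrightarrow>
     is_domain (cut_dom c) \<and> polygonal_domain (bg_dom c) \<and> cut_dom c \<subseteq> bg_dom c \<and>
     is_mesh (bg_mesh c) (bg_dom c) \<and>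
     fun_subspace (Vh c) \<and> Vh c \<subseteq> Wh k c \<inter> sobolev l (active_dom c) \<and>
     linear_map_between (Wh k c) (Vh c) (Ah c) \<and>
     linear_map_between (WhI k c) (Wh k c) (Fh c)"

definition quasiuniform :: "'n::finite cutfem set \<Rightarrow> bool" where
  "quasiuniform \<F> \<longleftrightarrow>
     (\<exists>c1>0. \<exists>c2>0. \<forall>c\<in>\<F>. \<forall>T\<in>bg_mesh c.
        (\<exists>x. ball x (c1 * hpar c) \<subseteq> T) \<and> diameter T \<le> c2 * hpar c)"

definition cutfem_family :: "nat \<Rightarrow> nat \<Rightarrow> real \<Rightarrow> 'n::finite cutfem set \<Rightarrow> bool" where
  "cutfem_family k l h0 \<F> \<longleftrightarrow>
     (\<forall>c\<in>\<F>. cutfem_setting k l c \<and> hpar c \<in> {0<..h0}) \<and> quasiuniform \<F>"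

definition assm_A1 :: "nat \<Rightarrow> 'n::finite cutfem set \<Rightarrow> bool" where
  "assm_A1 k \<F> \<longleftrightarrow>
     (\<forall>m. \<exists>C>0. \<forall>c\<in>\<F>. \<forall>w\<in>Wh k c.
        broken_sobolev_norm m (active_mesh c) w
          \<le> C * (hpar c powr (- real m) * broken_L2_norm (active_mesh c) w))"

text \<open>The approximation assumption for one order \<open>s\<close>.\<close>

definition assm_A2 :: "nat \<Rightarrow> nat \<Rightarrow> real \<Rightarrow> 'n::finite cutfem set \<Rightarrow> bool" where
  "assm_A2 k l s \<F> \<longleftrightarrow>
     (\<exists>C>0. \<forall>c\<in>\<F>. \<forall>v\<in>sobolev_real s (active_dom c).
        \<exists>vs\<in>Vh c. \<exists>ws\<in>WhE k c. \<forall>m::nat. m \<le> l \<and> real m \<le> s \<longrightarrow>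
          sobolev_norm m (active_dom c) (\<lambda>x. v x - vs x)
            \<le> C * (hpar c powr (s - real m) * sobolev_real_seminorm s (active_dom c) v) \<and>
          broken_sobolev_norm m (active_mesh c) (\<lambda>x. v x - ws x)
            \<le> C * (hpar c powr (s - real m) * sobolev_real_seminorm s (active_dom c) v))"

text \<open>Linearity of \<open>A\<^sub>h\<close> and \<open>F\<^sub>h\<close> is part of \<^const>\<open>cutfem_setting\<close>.\<close>

definition assm_A3 :: "nat \<Rightarrow> 'n::finite cutfem set \<Rightarrow> bool" where
  "assm_A3 k \<F> \<longleftrightarrow>
     (\<exists>C>0. \<forall>c\<in>\<F>. \<forall>v\<in>Wh k c.
        broken_L2_norm (active_mesh c) (Ah c v) \<le> C * broken_L2_norm (active_mesh c) v) \<and>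
     (\<forall>c\<in>\<F>. \<forall>v\<in>Vh c. Ah c v = v)"

definition assm_A4 :: "nat \<Rightarrow> nat \<Rightarrow> 'n::finite cutfem set \<Rightarrow> bool" where
  "assm_A4 k l \<F> \<longleftrightarrow>
     (\<forall>j\<le>l. \<exists>C>0. \<forall>c\<in>\<F>. \<forall>w\<in>WhI k c.
        broken_grad_norm j (active_mesh c) (Fh c w)
          \<le> C * broken_grad_norm j (interior_mesh c) w) \<and>
     (\<forall>c\<in>\<F>. \<forall>w\<in>WhE k c. Fh c (restr_I c w) = w)"

end

theory Submission
  imports Defs "HOL-Computational_Algebra.Polynomial"
begin

text \<open>Let \<open>v\<^sub>\<star> \<in> V\<^sub>h\<close> and \<open>w\<^sub>\<star> \<in> W\<^sub>h\<^sup>E\<close> be the approximations of \<open>v\<close> from A2 and take \<open>v\<^sub>\<star>\<^sup>E = A\<^sub>h F\<^sub>h (v\<^sub>\<star>)\<^sub>I\<close>.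
  As \<open>A\<^sub>h\<close> reproduces \<open>V\<^sub>h\<close>, \<open>v\<^sub>\<star> - v\<^sub>\<star>\<^sup>E = A\<^sub>h (v\<^sub>\<star> - F\<^sub>h (v\<^sub>\<star>)\<^sub>I)\<close>, so the inverse estimate and the
  \<open>L\<^sup>2\<close>-stability of \<open>A\<^sub>h\<close> reduce the claim to the \<open>L\<^sup>2\<close>-norm of \<open>v\<^sub>\<star> - F\<^sub>h (v\<^sub>\<star>)\<^sub>I\<close>. As \<open>F\<^sub>h\<close> reproduces
  \<open>w\<^sub>\<star>\<close>, this is controlled by \<open>\<parallel>v\<^sub>\<star> - w\<^sub>\<star>\<parallel>\<close>, hence by A2 with \<open>m = 0\<close>.

  Norms are defined through chosen representatives of weak derivatives. To add them, and to
  compare the norms on the active domain with the elementwise ones, weak derivatives must be unique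
  almost everywhere, which is the fundamental lemma of the calculus of variations. Testing with smooth
  approximations of indicators of boxes shows that all box integrals vanish, and a
  Dynkin argument finishes its proof.\<close>

section \<open>Smooth bump functions\<close>

text \<open>Polynomial factors in \<open>1 / t\<close> make the family closed under differentiation.\<close>

definition exp_poly :: "real poly \<Rightarrow> real \<Rightarrow> real" where
  "exp_poly p t = (if t > 0 then poly p (1 / t) * exp (- (1 / t)) else 0)"

lemma exp_poly_smult: "exp_poly (smult c p) t = c * exp_poly p t"
  by (simp add: exp_poly_def)

text \<open>With \<open>u = 1 / t\<close> this is the decay of \<open>exp_poly p t\<close> as
  \<open>t\<close> tends to 0 from the right, the one delicate point for differentiability. The
  exponential dominates each power.\<close>

lemma poly_mult_exp_minus_tendsto_0:
  "((\<lambda>u::real. poly p u * exp (- u)) \<longlongrightarrow> 0) at_top"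
proof -
  have "((\<lambda>u::real. \<Sum>i\<le>degree p. coeff p i * (u ^ i / exp u)) \<longlongrightarrow> (\<Sum>i\<le>degree p. coeff p i * 0)) at_top"
    by (intro tendsto_intros tendsto_power_div_exp_0)
  then show ?thesis
    by (simp add: poly_altdef sum_distrib_right exp_minus divide_inverse mult.assoc)
qed

text \<open>For \<open>t > 0\<close> the chain rule produces the factor 1 / t^2, which
  \<open>[:0, 0, 1:]\<close> turns into a polynomial factor in \<open>1 / t\<close>. The derivative
  thus stays in the family and the lemma can be iterated.\<close>

lemma exp_poly_has_derivative:
  "(exp_poly p has_real_derivative exp_poly ([:0, 0, 1:] * (p - pderiv p)) t) (at t)"
proof -
  consider "t > 0" | "t < 0" | "t = 0" by linarith
  then show ?thesis
  proof cases
    case 1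
    have "((\<lambda>t. poly p (1 / t) * exp (- (1 / t))) has_real_derivative
        poly p (1 / t) * (exp (- (1 / t)) * (1 / t\<^sup>2)) + poly (pderiv p) (1 / t) * (- (1 / t\<^sup>2)) * exp (- (1 / t))) (at t)"
      using 1 by (auto intro!: derivative_eq_intros DERIV_chain2[OF poly_DERIV]
          simp: power2_eq_square)
    moreover have "poly p (1 / t) * (exp (- (1 / t)) * (1 / t\<^sup>2)) + poly (pderiv p) (1 / t) * (- (1 / t\<^sup>2)) * exp (- (1 / t))
       = exp_poly ([:0, 0, 1:] * (p - pderiv p)) t"
      using 1 by (simp add: exp_poly_def field_simps power2_eq_square)
    ultimately have "((\<lambda>t. poly p (1 / t) * exp (- (1 / t))) has_real_derivative
        exp_poly ([:0, 0, 1:] * (p - pderiv p)) t) (at t)" by simp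
    then show ?thesis
      by (rule has_field_derivative_transform_within_open[where S = "{0<..}"])
        (use 1 in \<open>auto simp: exp_poly_def\<close>)
  next
    case 2
    have "((\<lambda>t. 0) has_real_derivative exp_poly ([:0, 0, 1:] * (p - pderiv p)) t) (at t)"
      using 2 by (simp add: exp_poly_def)
    then show ?thesis
      by (rule has_field_derivative_transform_within_open[where S = "{..<0}"])
        (use 2 in \<open>auto simp: exp_poly_def\<close>)
  next
    case 3
    \<comment> \<open>The difference quotient at 0 carries a further factor
      \<open>inverse y\<close>, which \<open>pCons 0 p\<close> absorbs.\<close>
    have "((\<lambda>y. poly (pCons 0 p) (inverse y) * exp (- inverse y)) \<longlongrightarrow> 0) (at_right 0)"
      by (rule filterlim_compose[OF poly_mult_exp_minus_tendsto_0 filterlim_inverse_at_top_right])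
    then have "((\<lambda>y. (exp_poly p y - exp_poly p 0) / (y - 0)) \<longlongrightarrow> 0) (at_right 0)"
      by (rule Lim_transform_eventually)
        (auto simp: eventually_at_filter exp_poly_def field_simps)
    moreover have "((\<lambda>y. (exp_poly p y - exp_poly p 0) / (y - 0)) \<longlongrightarrow> 0) (at_left 0)"
      by (rule Lim_transform_eventually[OF tendsto_const])
        (auto simp: eventually_at_filter exp_poly_def)
    ultimately show ?thesis
      unfolding 3 has_field_derivative_iff by (subst filterlim_split_at) (auto simp: exp_poly_def)
  qed
qed

text \<open>The algebra generated by the coordinate functions below is closed under partial derivatives, so
  smoothness in the sense of iterated Frechet derivatives follows from differentiability of its members.\<close>

inductive bump_alg :: "(real^'n::finite \<Rightarrow> real) \<Rightarrow> bool" where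
  const: "bump_alg (\<lambda>x. r)"
| base: "bump_alg (\<lambda>x. exp_poly p (c * x $ i + d))"
| add: "bump_alg f \<Longrightarrow> bump_alg g \<Longrightarrow> bump_alg (\<lambda>x. f x + g x)"
| mult: "bump_alg f \<Longrightarrow> bump_alg g \<Longrightarrow> bump_alg (\<lambda>x. f x * g x)"

lemma bump_alg_prod: "finite I \<Longrightarrow> (\<And>i. i \<in> I \<Longrightarrow> bump_alg (f i)) \<Longrightarrow> bump_alg (\<lambda>x. \<Prod>i\<in>I. f i x)"
  by (induction I rule: finite_induct) (auto intro: bump_alg.intros)

lemma bump_alg_partial:
  assumes "bump_alg f"
  shows "(\<forall>x. f differentiable (at x)) \<and>
     (\<forall>j. bump_alg (\<lambda>x. frechet_derivative f (at x) (axis j 1)))"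
  using assms
proof induction
  case (const r)
  then show ?case by (auto intro: bump_alg.intros)
next
  case (base p c i d)
  let ?q = "[:0, 0, 1:] * (p - pderiv p)"
  have d: "((\<lambda>x. exp_poly p (c * x $ i + d)) has_derivative (\<lambda>v. exp_poly ?q (c * x $ i + d) * (c * v $ i))) (at x)" for x :: "real^'a"
  proof -
    have "((\<lambda>x::real^'a. c * x $ i + d) has_derivative (\<lambda>v. c * v $ i)) (at x)"
      by (auto intro!: derivative_eq_intros bounded_linear_imp_has_derivative)
    from has_derivative_compose[OF this exp_poly_has_derivative[unfolded has_field_derivative_def]]
    show ?thesis by simp
  qed
  have "bump_alg (\<lambda>x. frechet_derivative (\<lambda>x. exp_poly p (c * x $ i + d)) (at x) (axis j 1))" for j
  proof -
    \<comment> \<open>The inner derivative is the constant \<open>c * axis j 1 $ i\<close>;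
      \<open>smult\<close> moves it into the polynomial, which restores the form required by
      \<open>base\<close>.\<close>
    have "(\<lambda>x. frechet_derivative (\<lambda>x. exp_poly p (c * x $ i + d)) (at x) (axis j 1)) =
      (\<lambda>x. exp_poly (smult (c * axis j 1 $ i) ?q) (c * x $ i + d))"
      unfolding frechet_derivative_at[OF d, symmetric] exp_poly_smult by (auto simp: mult_ac)
    then show ?thesis by (simp only: bump_alg.base)
  qed
  then show ?case using d unfolding differentiable_def by blast
next
  case (add f g)
  have "(\<lambda>x. frechet_derivative (\<lambda>x. f x + g x) (at x) (axis j 1)) =
     (\<lambda>x. frechet_derivative f (at x) (axis j 1) + frechet_derivative g (at x) (axis j 1))" for j
    using add.IH
    by (auto intro!: ext fun_cong[OF frechet_derivative_at[symmetric]] 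
        has_derivative_add simp: frechet_derivative_works)
  with add.IH show ?case by (auto intro: bump_alg.add)
next
  case (mult f g)
  have "(\<lambda>x. frechet_derivative (\<lambda>x. f x * g x) (at x) (axis j 1)) =
     (\<lambda>x. f x * frechet_derivative g (at x) (axis j 1) + frechet_derivative f (at x) (axis j 1) * g x)" for j
    using mult.IH
    by (auto intro!: ext fun_cong[OF frechet_derivative_at[symmetric]] 
        has_derivative_mult simp: frechet_derivative_works)
  with mult show ?case by (auto intro!: bump_alg.intros)
qed

lemma bump_alg_smooth:
  assumes "bump_alg f"
  shows "smooth_fun f"
proof -
  have "bump_alg (iter_partial is f)" for "is"
    using assms by (induction "is") (simp_all add: bump_alg_partial)
  then show ?thesis
    by (simp add: smooth_fun_def bump_alg_partial)
qed

text \<open>As \<open>N\<close> grows, each factor \<open>exp (- 1 / (N t))\<close> with \<open>t > 0\<close> tends to 1, so these functions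
  approximate the indicator of the box without any plateau construction.\<close>

definition box_bump :: "real^'n::finite \<Rightarrow> real^'n \<Rightarrow> real \<Rightarrow> real^'n \<Rightarrow> real" where
  "box_bump a b N x =
     (\<Prod>i\<in>UNIV. exp_poly 1 (N * (x $ i - a $ i)) * exp_poly 1 (N * (b $ i - x $ i)))"

lemma box_bump_smooth: "smooth_fun (box_bump a b N)"
proof -
  \<comment> \<open>Both arguments are brought into the affine form \<open>c * x $ i + d\<close> of
    the generators.\<close>
  have "bump_alg (\<lambda>x. \<Prod>i\<in>UNIV. exp_poly 1 (N * x $ i + (- N * a $ i)) * exp_poly 1 ((- N) * x $ i + N * b $ i))"
    by (intro bump_alg_prod bump_alg.intros) auto
  then show ?thesis
    by (intro bump_alg_smooth) (simp add: box_bump_def[abs_def] algebra_simps)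
qed

lemma exp_poly_1_bounds: "0 \<le> exp_poly 1 t" "exp_poly 1 t \<le> 1"
  by (auto simp: exp_poly_def)

lemma box_bump_bounds: "0 \<le> box_bump a b N x" "box_bump a b N x \<le> 1"
  unfolding box_bump_def
  by (auto intro!: prod_nonneg prod_le_1 mult_nonneg_nonneg mult_le_one exp_poly_1_bounds)

lemma box_bump_outside:
  assumes "x \<notin> box a b" "N > 0"
  shows "box_bump a b N x = 0"
proof -
  obtain i where "x $ i \<le> a $ i \<or> b $ i \<le> x $ i"
    using assms(1) by (auto simp: mem_box_cart not_less)
  then have "exp_poly 1 (N * (x $ i - a $ i)) * exp_poly 1 (N * (b $ i - x $ i)) = 0"
    using assms(2) by (auto simp: exp_poly_def zero_less_mult_iff)
  then show ?thesis unfolding box_bump_def by (intro prod_zero) auto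
qed

text \<open>The support lies in the closed box, hence the inclusion of \<open>cbox\<close> and not
  just of \<open>box\<close> in \<open>S\<close>.\<close>

lemma test_fun_box_bump:
  assumes "cbox a b \<subseteq> S" "N > 0"
  shows "test_fun S (box_bump a b N)"
proof -
  have "closure {x. box_bump a b N x \<noteq> 0} \<subseteq> cbox a b"
    by (rule closure_minimal) (use box_bump_outside[of _ a b N] assms(2) box_subset_cbox in \<open>auto\<close>)
  moreover from this have "compact (closure {x. box_bump a b N x \<noteq> 0})"
    by (meson bounded_cbox bounded_subset closed_closure compact_eq_bounded_closed)
  ultimately show ?thesis
    using assms(1) by (auto simp: test_fun_def box_bump_smooth)
qed

lemma box_bump_tendsto_indicator:
  "(\<lambda>n. box_bump a b (real (Suc n)) x) \<longlonglongrightarrow> indicator (box a b) x"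
proof (cases "x \<in> box a b")
  case True
  have lim: "(\<lambda>n. exp_poly 1 (real (Suc n) * t)) \<longlonglongrightarrow> 1" if "t > 0" for t
  proof -
    have "(\<lambda>n. exp (- (inverse (real (Suc n)) * (1 / t)))) \<longlonglongrightarrow> exp (- (0 * (1 / t)))"
      by (intro tendsto_intros LIMSEQ_inverse_real_of_nat)
    moreover have "exp_poly 1 (real (Suc n) * t) = exp (- (inverse (real (Suc n)) * (1 / t)))" for n
      using that by (simp add: exp_poly_def field_simps del: of_nat_Suc)
    ultimately show ?thesis by simp
  qed
  have "(\<lambda>n. box_bump a b (real (Suc n)) x) \<longlonglongrightarrow> (\<Prod>i\<in>(UNIV::'a set). 1 * 1)"
    unfolding box_bump_def using True
    by (intro tendsto_prod tendsto_mult lim) (auto simp: mem_box_cart)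
  with True show ?thesis by simp
next
  case False
  then show ?thesis by (simp add: box_bump_outside)
qed

section \<open>Square integrable functions and the fundamental lemma\<close>

lemma L2_mult_integrable:
  assumes "u \<in> L2 S" "v \<in> L2 S"
  shows "set_integrable lebesgue S (\<lambda>x. u x * v x)"
  unfolding set_integrable_def
proof (rule Bochner_Integration.integrable_bound)
  show "integrable lebesgue (\<lambda>x. indicator S x *\<^sub>R (u x)\<^sup>2 + indicator S x *\<^sub>R (v x)\<^sup>2)"
    using assms by (auto simp: L2_def set_integrable_def)
  \<comment> \<open>Membership in \<open>L2\<close> makes the cut-off functions measurable, so the
    product is formed from these; squaring the indicator changes nothing.\<close>
  have "(\<lambda>x. (indicator S x *\<^sub>R u x) * (indicator S x *\<^sub>R v x)) \<in> borel_measurable lebesgue"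
    using assms by (intro borel_measurable_times) (auto simp: L2_def set_borel_measurable_def)
  also have "(\<lambda>x. (indicator S x *\<^sub>R u x) * (indicator S x *\<^sub>R v x)) = (\<lambda>x. indicator S x *\<^sub>R (u x * v x))"
    by (auto simp: indicator_def)
  finally show "(\<lambda>x. indicator S x *\<^sub>R (u x * v x)) \<in> borel_measurable lebesgue" .
  have "\<bar>a * b\<bar> \<le> a\<^sup>2 + b\<^sup>2" for a b :: real
  proof -
    have "2 * (\<bar>a\<bar> * \<bar>b\<bar>) \<le> a\<^sup>2 + b\<^sup>2"
      using sum_squares_bound[of "\<bar>a\<bar>" "\<bar>b\<bar>"] by (simp add: mult.assoc)
    then show ?thesis
      using mult_nonneg_nonneg[of "\<bar>a\<bar>" "\<bar>b\<bar>"] unfolding abs_mult by linarith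
  qed
  then show "AE x in lebesgue. norm (indicator S x *\<^sub>R (u x * v x))
      \<le> norm (indicator S x *\<^sub>R (u x)\<^sup>2 + indicator S x *\<^sub>R (v x)\<^sup>2)"
    by (auto simp: indicator_def)
qed

lemma L2_scale:
  assumes "u \<in> L2 S"
  shows "(\<lambda>x. a * u x) \<in> L2 S"
proof -
  have "(\<lambda>x. a * (indicator S x *\<^sub>R u x)) \<in> borel_measurable lebesgue"
    "integrable lebesgue (\<lambda>x. a\<^sup>2 * (indicator S x *\<^sub>R (u x)\<^sup>2))"
    using assms by (auto simp: L2_def set_borel_measurable_def set_integrable_def)
  then show ?thesis
    by (simp add: L2_def set_borel_measurable_def set_integrable_def power_mult_distrib mult_ac)
qed

lemma L2_add:
  assumes "u \<in> L2 S" "v \<in> L2 S"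
  shows "(\<lambda>x. u x + v x) \<in> L2 S"
proof -
  have "(\<lambda>x. indicator S x *\<^sub>R u x + indicator S x *\<^sub>R v x) \<in> borel_measurable lebesgue"
    using assms by (intro borel_measurable_add) (auto simp: L2_def set_borel_measurable_def)
  moreover have "set_integrable lebesgue S (\<lambda>x. (u x)\<^sup>2 + (v x)\<^sup>2 + 2 * (u x * v x))"
    using assms L2_mult_integrable[OF assms]
    by (intro set_integral_add(1) set_integrable_mult_right) (auto simp: L2_def)
  ultimately show ?thesis
    by (simp add: L2_def set_borel_measurable_def power2_sum scaleR_add_right algebra_simps)
qed

lemma L2_diff:
  assumes "u \<in> L2 S" "v \<in> L2 S"
  shows "(\<lambda>x. u x - v x) \<in> L2 S"
  using L2_add[OF assms(1) L2_scale[OF assms(2), of "-1"]] by simp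

lemma L2_subset:
  assumes "u \<in> L2 S" "A \<subseteq> S" "A \<in> sets lebesgue"
  shows "u \<in> L2 A"
  using assms by (auto simp: L2_def intro: set_integrable_subset set_borel_measurable_subset)

section \<open>The L2 norm on a set\<close>

lemma L2_norm_on_nonneg: "0 \<le> L2_norm_on S u"
  by (auto simp: L2_norm_on_def set_lebesgue_integral_def intro!: integral_nonneg_AE)

lemma L2_norm_on_power2: "(L2_norm_on S u)\<^sup>2 = (LINT x:S|lebesgue. (u x)\<^sup>2)"
  by (auto simp: L2_norm_on_def set_lebesgue_integral_def intro!: integral_nonneg_AE)

text \<open>Pointwise, (a + b)^2 <= 2 a^2 + 2 b^2. In this squared form the estimate survives sums
  over derivatives and over elements.\<close>

lemma L2_norm_on_add:
  assumes "u \<in> L2 S" "v \<in> L2 S"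
  shows "(L2_norm_on S (\<lambda>x. u x + v x))\<^sup>2 \<le> 2 * (L2_norm_on S u)\<^sup>2 + 2 * (L2_norm_on S v)\<^sup>2"
proof -
  have i: "set_integrable lebesgue S (\<lambda>x. (u x)\<^sup>2)" "set_integrable lebesgue S (\<lambda>x. (v x)\<^sup>2)"
    "set_integrable lebesgue S (\<lambda>x. (u x + v x)\<^sup>2)"
    using assms L2_add[OF assms] by (auto simp: L2_def)
  have "(LINT x:S|lebesgue. (u x + v x)\<^sup>2) \<le> (LINT x:S|lebesgue. 2 * (u x)\<^sup>2 + 2 * (v x)\<^sup>2)"
  proof (rule set_integral_mono)
    show "set_integrable lebesgue S (\<lambda>x. 2 * (u x)\<^sup>2 + 2 * (v x)\<^sup>2)"
      using i by (intro set_integral_add(1) set_integrable_mult_right) auto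
    show "(u x + v x)\<^sup>2 \<le> 2 * (u x)\<^sup>2 + 2 * (v x)\<^sup>2" for x
      using sum_squares_bound[of "u x" "v x"] by (simp add: power2_sum)
  qed (rule i)
  also have "\<dots> = 2 * (LINT x:S|lebesgue. (u x)\<^sup>2) + 2 * (LINT x:S|lebesgue. (v x)\<^sup>2)"
    using i by (subst set_integral_add(2)) auto
  finally show ?thesis by (simp add: L2_norm_on_power2)
qed

lemma L2_norm_on_cong_AE:
  assumes "u \<in> L2 S" "v \<in> L2 S" "AE x in lebesgue. x \<in> S \<longrightarrow> u x = v x"
  shows "L2_norm_on S u = L2_norm_on S v"
proof -
  have "(LINT x:S|lebesgue. (u x)\<^sup>2) = (LINT x:S|lebesgue. (v x)\<^sup>2)"
    unfolding set_lebesgue_integral_def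
    using assms by (intro integral_cong_AE)
     (auto simp: L2_def set_integrable_def indicator_def elim!: eventually_mono)
  then show ?thesis by (simp add: L2_norm_on_def)
qed

lemma L2_norm_on_null_diff:
  assumes "u \<in> L2 S" "A \<subseteq> S" "A \<in> sets lebesgue" "S - A \<in> null_sets lebesgue"
  shows "L2_norm_on A u = L2_norm_on S u"
proof -
  have "(LINT x:A|lebesgue. (u x)\<^sup>2) = (LINT x:S|lebesgue. (u x)\<^sup>2)"
  proof (rule set_integral_cong_set)
    show "set_borel_measurable lebesgue S (\<lambda>x. (u x)\<^sup>2)" "set_borel_measurable lebesgue A (\<lambda>x. (u x)\<^sup>2)"
      using assms(1) L2_subset[OF assms(1-3)]
      by (auto simp: L2_def set_integrable_def set_borel_measurable_def)
    show "AE x in lebesgue. (x \<in> S) = (x \<in> A)"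
      using AE_not_in[OF assms(4)] by eventually_elim (use assms(2) in auto)
  qed
  then show ?thesis by (simp add: L2_norm_on_def)
qed

text \<open>Open boxes generate the Borel sets and are closed under intersection, so a Dynkin
  argument extends the vanishing integrals to all Borel sets; the total integral handles
  complements. Testing with sign sets then forces \<open>f\<close> to vanish.\<close>

lemma AE_zero_if_box_integrals_zero:
  fixes f :: "real^'n::finite \<Rightarrow> real"
  assumes int: "integrable lebesgue f" and tot: "integral\<^sup>L lebesgue f = 0"
    and box: "\<And>a b. (LINT x:box a b|lebesgue. f x) = 0"
  shows "AE x in lebesgue. f x = 0"
proof -
  have si: "set_integrable lebesgue A f" if "A \<in> sets borel" for A
    using integrable_mult_indicator[of A lebesgue f] that int
    by (auto simp: set_integrable_def)
  have zero: "(LINT x:A|lebesgue. f x) = 0" if "A \<in> sets borel" for A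
  proof -
    have borel: "sets borel = sigma_sets UNIV (range (\<lambda>(a::real^'n, b). box a b))"
      by (subst borel_eq_box) (auto intro: sets_measure_of)
    have "Int_stable (range (\<lambda>(a::real^'n, b). box a b))"
      by (auto simp: Int_stable_def Int_interval box_Int_box)
    moreover have "range (\<lambda>(a::real^'n, b). box a b) \<subseteq> Pow UNIV" by simp
    ultimately show ?thesis
      using that[unfolded borel]
    proof (induction rule: sigma_sets_induct_disjoint)
      case (basic A)
      then show ?case using box by auto
    next
      case empty
      show ?case by (simp add: set_lebesgue_integral_def)
    next
      case (compl A)
      then have A: "A \<in> sets borel" by (simp add: borel)
      have "(LINT x:A \<union> (UNIV - A)|lebesgue. f x) = (LINT x:A|lebesgue. f x) + (LINT x:UNIV - A|lebesgue. f x)"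
        by (rule set_integral_Un) (use A in \<open>auto intro!: si\<close>)
      then show ?case using compl tot by (simp add: set_lebesgue_integral_def)
    next
      case (union A)
      then have A: "A i \<in> sets borel" for i by (auto simp: borel)
      have "(LINT x:(\<Union>i. A i)|lebesgue. f x) = (\<Sum>i. (LINT x:(A i)|lebesgue. f x))"
        by (rule lebesgue_integral_countable_add)
          (use A union in \<open>auto intro!: si simp: disjoint_family_on_def\<close>)
      then show ?case using union by simp
    qed
  qed
  \<comment> \<open>The sign sets of \<open>f\<close> need not be Borel, as \<open>f\<close> is only
    Lebesgue measurable; those of the Borel version \<open>f'\<close> are.\<close>
  obtain f' where f': "f' \<in> borel_measurable lborel" "AE x in lborel. f x = f' x"
    using completion_ex_borel_measurable_real[OF borel_measurable_integrable[OF int]] by auto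
  have ae: "AE x in lebesgue. f x = f' x"
    using f'(2) by (rule AE_completion)
  \<comment> \<open>On \<open>A\<close> the function \<open>\<sigma> * f\<close> is nonnegative
    almost everywhere and has integral zero. The choices 1 and -1 of \<open>\<sigma>\<close> serve
    the sets where \<open>f'\<close> is nonnegative and nonpositive, which together cover the
    space.\<close>
  have half: "AE x in lebesgue. indicator A x * f x = 0"
    if A: "A \<in> sets borel" and s: "AE x in lebesgue. 0 \<le> indicator A x * (\<sigma> * f x)" and n: "\<sigma> \<noteq> 0" for A \<sigma>
  proof -
    have "integral\<^sup>L lebesgue (\<lambda>x. indicator A x * (\<sigma> * f x)) = \<sigma> * (LINT x:A|lebesgue. f x)"
      by (simp add: set_lebesgue_integral_def mult.left_commute)
    moreover have "integrable lebesgue (\<lambda>x. indicator A x * (\<sigma> * f x))"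
      using si[OF A] by (simp add: set_integrable_def mult.left_commute)
    ultimately have "AE x in lebesgue. indicator A x * (\<sigma> * f x) = 0"
      using integral_nonneg_eq_0_iff_AE[OF _ s] zero[OF A] by simp
    then show ?thesis by eventually_elim (use n in auto)
  qed
  have "AE x in lebesgue. indicator {x. 0 \<le> f' x} x * f x = 0"
    by (rule half[where \<sigma> = 1, OF _ eventually_mono[OF ae]]) (use f'(1) in \<open>auto simp: indicator_def\<close>)
  moreover have "AE x in lebesgue. indicator {x. f' x \<le> 0} x * f x = 0"
    by (rule half[where \<sigma> = "-1", OF _ eventually_mono[OF ae]]) (use f'(1) in \<open>auto simp: indicator_def\<close>)
  ultimately show ?thesis
    by eventually_elim (auto simp: indicator_def split: if_splits)
qed

text \<open>Boxes are bounded, so the constant 1 is square integrable on \<open>A\<close> and its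
  product with \<open>g\<close> is integrable.\<close>

lemma L2_integrable_on_cbox:
  fixes g :: "real^'n::finite \<Rightarrow> real"
  assumes "g \<in> L2 S" "cbox a b \<subseteq> S" "A \<subseteq> cbox a b" "A \<in> sets borel"
  shows "set_integrable lebesgue A g"
proof -
  have "(\<lambda>x. 1) \<in> L2 A"
  proof -
    have "set_integrable lebesgue (cbox a b) (\<lambda>x. 1::real)"
      using lmeasurable_cbox[of a b] by (auto simp: set_integrable_def fmeasurable_def intro!: integrable_real_indicator)
    then have "set_integrable lebesgue A (\<lambda>x. 1::real)"
      by (rule set_integrable_subset) (use assms in auto)
    moreover have "(\<lambda>x. indicator A x *\<^sub>R (1::real)) \<in> borel_measurable lebesgue"
      unfolding real_scaleR_def mult_1_right using assms(4) by (intro borel_measurable_indicator) simp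
    ultimately show ?thesis
      by (simp add: L2_def set_borel_measurable_def)
  qed
  moreover have "g \<in> L2 A" by (rule L2_subset[OF assms(1)]) (use assms in auto)
  ultimately show ?thesis using L2_mult_integrable[of g A "\<lambda>x. 1"] by simp
qed

text \<open>Dominated convergence of the bumps gives zero integrals over boxes whose closed version
  lies in \<open>S\<close>; on each such box \<open>g\<close> vanishes by
  \<open>AE_zero_if_box_integrals_zero\<close>; countably many of them exhaust
  \<open>S\<close>.\<close>

lemma fundamental_lemma_L2:
  fixes g :: "real^'n::finite \<Rightarrow> real"
  assumes "open S" and g: "g \<in> L2 S"
    and zero: "\<And>\<phi>. test_fun S \<phi> \<Longrightarrow> (LINT x:S|lebesgue. g x * \<phi> x) = 0"
  shows "AE x in lebesgue. x \<in> S \<longrightarrow> g x = 0"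
proof -
  have box: "(LINT x:box a b|lebesgue. g x) = 0" if sub: "cbox a b \<subseteq> S" for a b
  proof -
    let ?f = "\<lambda>n x. indicator (box a b) x * g x * box_bump a b (real (Suc n)) x"
    have i: "integrable lebesgue (\<lambda>x. indicator (box a b) x * g x)"
      using L2_integrable_on_cbox[OF g sub box_subset_cbox] by (simp add: set_integrable_def)
    \<comment> \<open>The bump vanishes off the box, so cutting off by the box or by
      \<open>S\<close> gives the same function, and the hypothesis on test functions
      applies.\<close>
    have f: "?f n = (\<lambda>x. indicator S x *\<^sub>R (g x * box_bump a b (real (Suc n)) x))" for n
      using sub box_subset_cbox[of a b] box_bump_outside[of _ a b "real (Suc n)"]
      by (intro ext) (auto simp: indicator_def)
    have "(\<lambda>n. integral\<^sup>L lebesgue (?f n)) \<longlonglongrightarrow> integral\<^sup>L lebesgue (\<lambda>x. indicator (box a b) x * g x)"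
    proof (rule integral_dominated_convergence)
      show "integrable lebesgue (\<lambda>x. \<bar>indicator (box a b) x * g x\<bar>)"
        using i by (rule integrable_abs)
      show "?f n \<in> borel_measurable lebesgue" for n
      proof (rule borel_measurable_times[OF borel_measurable_integrable[OF i]])
        have "continuous_on UNIV (box_bump a b (real (Suc n)))"
          using box_bump_smooth[of a b "real (Suc n)", unfolded smooth_fun_def, rule_format, of "[]"]
          by (auto intro!: continuous_at_imp_continuous_on differentiable_imp_continuous_within)
        then show "box_bump a b (real (Suc n)) \<in> borel_measurable lebesgue"
          by (simp add: borel_measurable_continuous_onI measurable_completion)
      qed
      show "AE x in lebesgue. (\<lambda>n. ?f n x) \<longlonglongrightarrow> indicator (box a b) x * g x"
      proof (intro AE_I2)
        fix x
        have "(\<lambda>n. ?f n x) \<longlonglongrightarrow> indicator (box a b) x * g x * indicator (box a b) x"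
          by (intro tendsto_mult tendsto_const box_bump_tendsto_indicator)
        then show "(\<lambda>n. ?f n x) \<longlonglongrightarrow> indicator (box a b) x * g x"
          by (cases "x \<in> box a b") simp_all
      qed
      show "AE x in lebesgue. norm (?f n x) \<le> \<bar>indicator (box a b) x * g x\<bar>" for n
        using box_bump_bounds[of a b "real (Suc n)"]
        by (auto simp: abs_mult mult_left_le)
    qed (use i in auto)
    moreover have "integral\<^sup>L lebesgue (?f n) = 0" for n
      unfolding f using zero[OF test_fun_box_bump[OF sub, of "real (Suc n)"]]
      by (simp add: set_lebesgue_integral_def)
    ultimately show ?thesis
      by (simp add: set_lebesgue_integral_def LIMSEQ_const_iff)
  qed
  have cbox: "AE x in lebesgue. x \<in> cbox a b \<longrightarrow> g x = 0" if sub: "cbox a b \<subseteq> S" for a b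
  proof -
    \<comment> \<open>The cut-off is integrable on the whole space. Its integral over a box is that
      of \<open>g\<close> over the intersection with \<open>box a b\<close>, again a box covered by
      the first claim.\<close>
    let ?f = "\<lambda>x. indicator (box a b) x * g x"
    have "AE x in lebesgue. ?f x = 0"
    proof (rule AE_zero_if_box_integrals_zero)
      show "integrable lebesgue ?f"
        using L2_integrable_on_cbox[OF g sub box_subset_cbox] by (simp add: set_integrable_def)
      show "integral\<^sup>L lebesgue ?f = 0"
        using box[OF sub] by (simp add: set_lebesgue_integral_def)
      fix c d :: "real^'n"
      obtain c' d' where cd: "box c d \<inter> box a b = box c' d'" "cbox c' d' \<subseteq> cbox a b"
      proof
        let ?c = "\<Sum>i\<in>Basis. max (c \<bullet> i) (a \<bullet> i) *\<^sub>R i" and ?d = "\<Sum>i\<in>Basis. min (d \<bullet> i) (b \<bullet> i) *\<^sub>R i"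
        show "box c d \<inter> box a b = box ?c ?d" by (rule box_Int_box)
        show "cbox ?c ?d \<subseteq> cbox a b" by (auto simp: mem_box)
      qed
      have "(LINT x:box c d|lebesgue. ?f x) = (LINT x:box c' d'|lebesgue. g x)"
        by (auto simp: set_lebesgue_integral_def indicator_inter_arith cd(1)[symmetric] mult.assoc)
      then show "(LINT x:box c d|lebesgue. ?f x) = 0" using box cd(2) sub by auto
    qed
    \<comment> \<open>The faces separating the closed from the open box are null.\<close>
    moreover have "cbox a b - box a b \<in> null_sets lebesgue"
      using negligible_frontier_interval[of a b] by (simp add: negligible_iff_null_sets)
    then have "AE x in lebesgue. x \<notin> cbox a b - box a b" by (rule AE_not_in)
    ultimately show ?thesis by eventually_elim (auto simp: indicator_def)
  qed
  obtain \<D> where D: "countable \<D>" "\<D> \<subseteq> Pow S" "\<And>X. X \<in> \<D> \<Longrightarrow> \<exists>a b. X = cbox a b" "\<Union>\<D> = S"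
    using open_countable_Union_open_cbox[OF \<open>open S\<close>] by metis
  have "AE x in lebesgue. \<forall>X\<in>\<D>. x \<in> X \<longrightarrow> g x = 0"
    using D cbox by (subst AE_ball_countable) (auto, metis PowD subsetD)
  then show ?thesis by eventually_elim (use D(4) in auto)
qed

section \<open>Weak derivatives and Sobolev norms\<close>

lemma iter_partial_append: "iter_partial (is @ js) f = iter_partial is (iter_partial js f)"
  by (induction "is") auto

text \<open>Derivatives are local: as \<open>U\<close> is open, the zero function may replace
  \<open>f\<close> near \<open>x\<close>.\<close>

lemma iter_partial_zero_on_open:
  assumes "open U" "\<And>x. x \<in> U \<Longrightarrow> f x = 0" "x \<in> U"
  shows "iter_partial is f x = 0"
  using assms(3)
proof (induction "is" arbitrary: x)
  case Nil
  then show ?case using assms(2) by simp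
next
  case (Cons i "is")
  have "((\<lambda>x. 0::real) has_derivative (\<lambda>v. 0)) (at x)" by simp
  then have "(iter_partial is f has_derivative (\<lambda>v. 0)) (at x)"
    by (rule has_derivative_transform_within_open[OF _ assms(1)]) (use Cons in auto)
  from frechet_derivative_at[OF this] show ?case by (metis iter_partial.simps(2))
qed

text \<open>Differentiation does not enlarge the support. The derivatives in
  \<open>is_weak_deriv\<close> are therefore test functions, hence in \<open>L2\<close>, and
  integrals against them can be split.\<close>

lemma test_fun_iter_partial:
  assumes "test_fun S \<phi>"
  shows "test_fun S (iter_partial is \<phi>)"
proof -
  define K where "K = closure {x. \<phi> x \<noteq> 0}"
  have K: "closed K" "compact K" "K \<subseteq> S"
    using assms by (auto simp: K_def test_fun_def)
  have "\<phi> x = 0" if "x \<in> - K" for x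
    using that closure_subset[of "{x. \<phi> x \<noteq> 0}"] by (auto simp: K_def)
  then have "iter_partial is \<phi> x = 0" if "x \<notin> K" for x
    using K(1) that by (intro iter_partial_zero_on_open[of "- K" \<phi>]) (auto simp: open_Compl)
  then have sub: "closure {x. iter_partial is \<phi> x \<noteq> 0} \<subseteq> K"
    by (intro closure_minimal K(1)) blast
  moreover have "compact (closure {x. iter_partial is \<phi> x \<noteq> 0})"
    using K(2) sub unfolding compact_eq_bounded_closed by (blast intro: bounded_subset closed_closure)
  moreover have "smooth_fun (iter_partial is \<phi>)"
    using assms by (auto simp: test_fun_def smooth_fun_def simp flip: iter_partial_append)
  ultimately show ?thesis using K(3) by (auto simp: test_fun_def)
qed

lemma test_fun_mono: "test_fun S \<phi> \<Longrightarrow> S \<subseteq> S' \<Longrightarrow> test_fun S' \<phi>"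
  by (auto simp: test_fun_def)

lemma test_fun_outside: "test_fun S \<phi> \<Longrightarrow> x \<notin> S \<Longrightarrow> \<phi> x = 0"
  unfolding test_fun_def using closure_subset[of "{x. \<phi> x \<noteq> 0}"] by auto

lemma continuous_mult_indicator_compact_integrable:
  fixes f :: "'a::euclidean_space \<Rightarrow> real"
  assumes "continuous_on UNIV f" "compact K"
  shows "integrable lebesgue (\<lambda>x. indicator K x *\<^sub>R f x)"
proof -
  have "integrable lborel (\<lambda>x. indicator K x *\<^sub>R f x)"
    using assms by (intro borel_integrable_compact) (auto intro: continuous_on_subset)
  then show ?thesis
    by (simp add: integrable_completion borel_measurable_integrable)
qed

lemma continuous_in_L2_compact:
  assumes "continuous_on UNIV f" "compact K" "A \<subseteq> K" "A \<in> sets lebesgue"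
  shows "f \<in> L2 A"
proof -
  have "f \<in> L2 K"
    using continuous_mult_indicator_compact_integrable[OF assms(1,2)]
      continuous_mult_indicator_compact_integrable[of "\<lambda>x. (f x)\<^sup>2", OF _ assms(2)] assms(1)
    by (auto simp: L2_def set_borel_measurable_def set_integrable_def intro!: continuous_intros borel_measurable_integrable)
  then show ?thesis using assms(3,4) by (rule L2_subset)
qed

lemma test_fun_L2:
  assumes "test_fun S \<phi>"
  shows "\<phi> \<in> L2 S"
proof -
  define K where "K = closure {x. \<phi> x \<noteq> 0}"
  have K: "compact K" "K \<subseteq> S" using assms by (auto simp: K_def test_fun_def)
  have zero: "\<phi> x = 0" if "x \<notin> K" for x
    using that closure_subset[of "{x. \<phi> x \<noteq> 0}"] by (auto simp: K_def)
  have "continuous_on UNIV \<phi>"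
    using assms unfolding test_fun_def smooth_fun_def
    by (metis continuous_at_imp_continuous_on differentiable_imp_continuous_within iter_partial.simps(1))
  then have "\<phi> \<in> L2 K"
    using K by (intro continuous_in_L2_compact[of _ K]) (auto intro: lmeasurable_compact fmeasurableD)
  \<comment> \<open>As \<open>\<phi>\<close> vanishes off \<open>K\<close>, cutting off by
    \<open>K\<close> or by \<open>S\<close> gives the same functions, which carries membership from
    \<open>L2 K\<close> to \<open>L2 S\<close>.\<close>
  moreover have "(\<lambda>x. indicator K x *\<^sub>R \<phi> x) = (\<lambda>x. indicator S x *\<^sub>R \<phi> x)"
    "(\<lambda>x. indicator K x *\<^sub>R (\<phi> x)\<^sup>2) = (\<lambda>x. indicator S x *\<^sub>R (\<phi> x)\<^sup>2)"
    using K(2) zero by (auto simp: indicator_def intro!: ext)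
  ultimately show ?thesis
    unfolding L2_def set_borel_measurable_def set_integrable_def by simp
qed

text \<open>The difference of the candidates integrates to zero against every test function. This
  frees the norms from the representative that \<open>weak_deriv\<close> happens to choose.\<close>

lemma is_weak_deriv_unique:
  assumes S: "open S" and g: "g \<in> L2 S" "g' \<in> L2 S"
    and "is_weak_deriv S is u g" "is_weak_deriv S is u g'"
  shows "AE x in lebesgue. x \<in> S \<longrightarrow> g x = g' x"
proof -
  have "AE x in lebesgue. x \<in> S \<longrightarrow> g x - g' x = 0"
  proof (rule fundamental_lemma_L2[OF S L2_diff[OF g]])
    fix \<phi> assume \<phi>: "test_fun S \<phi>"
    have "(LINT x:S|lebesgue. (g x - g' x) * \<phi> x) =
        (LINT x:S|lebesgue. g x * \<phi> x) - (LINT x:S|lebesgue. g' x * \<phi> x)"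
      unfolding left_diff_distrib
      by (intro set_integral_diff(2) L2_mult_integrable g test_fun_L2 \<phi>)
    also have "\<dots> = 0"
    proof -
      have "(- 1) ^ length is * (LINT x:S|lebesgue. g x * \<phi> x) = (- 1) ^ length is * (LINT x:S|lebesgue. g' x * \<phi> x)"
        using assms(4,5) \<phi> unfolding is_weak_deriv_def by metis
      then show ?thesis by simp
    qed
    finally show "(LINT x:S|lebesgue. (g x - g' x) * \<phi> x) = 0" .
  qed
  then show ?thesis by simp
qed

lemma is_weak_deriv_add:
  assumes "u \<in> L2 S" "v \<in> L2 S" "g \<in> L2 S" "k \<in> L2 S"
    and "is_weak_deriv S is u g" "is_weak_deriv S is v k"
  shows "is_weak_deriv S is (\<lambda>x. u x + v x) (\<lambda>x. g x + k x)"
  unfolding is_weak_deriv_def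
proof (intro allI impI)
  fix \<phi> assume \<phi>: "test_fun S \<phi>"
  note D = test_fun_L2[OF test_fun_iter_partial[OF \<phi>, of "is"]] and L = test_fun_L2[OF \<phi>]
  have "(LINT x:S|lebesgue. (u x + v x) * iter_partial is \<phi> x) =
      (LINT x:S|lebesgue. u x * iter_partial is \<phi> x) + (LINT x:S|lebesgue. v x * iter_partial is \<phi> x)"
    unfolding distrib_right by (intro set_integral_add(2) L2_mult_integrable assms D)
  moreover have "(LINT x:S|lebesgue. (g x + k x) * \<phi> x) =
      (LINT x:S|lebesgue. g x * \<phi> x) + (LINT x:S|lebesgue. k x * \<phi> x)"
    unfolding distrib_right by (intro set_integral_add(2) L2_mult_integrable assms L)
  ultimately show "(LINT x:S|lebesgue. (u x + v x) * iter_partial is \<phi> x) =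
      (- 1) ^ length is * (LINT x:S|lebesgue. (g x + k x) * \<phi> x)"
    using assms(5,6) \<phi> by (simp add: is_weak_deriv_def distrib_left)
qed

lemma is_weak_deriv_scale:
  assumes "is_weak_deriv S is u g"
  shows "is_weak_deriv S is (\<lambda>x. a * u x) (\<lambda>x. a * g x)"
  using assms by (simp add: is_weak_deriv_def mult.assoc)

text \<open>A test function on \<open>S'\<close> is also one on \<open>S\<close> and vanishes off
  \<open>S'\<close>, so the integrals agree. This passes derivatives from the active domain to an
  element.\<close>

lemma is_weak_deriv_subset:
  assumes "is_weak_deriv S is u g" "S' \<subseteq> S"
  shows "is_weak_deriv S' is u g"
  unfolding is_weak_deriv_def
proof (intro allI impI)
  fix \<phi> assume \<phi>: "test_fun S' \<phi>"
  have eq: "(LINT x:S'|lebesgue. f x * \<psi> x) = (LINT x:S|lebesgue. f x * \<psi> x)"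
    if "test_fun S' \<psi>" for f \<psi> :: "_ \<Rightarrow> real"
    unfolding set_lebesgue_integral_def
    using test_fun_outside[OF that] assms(2)
    by (intro Bochner_Integration.integral_cong) (auto simp: indicator_def)
  show "(LINT x:S'|lebesgue. u x * iter_partial is \<phi> x) = (-1) ^ length is * (LINT x:S'|lebesgue. g x * \<phi> x)"
    using assms(1) test_fun_mono[OF \<phi> assms(2)]
    by (simp add: eq[OF \<phi>] eq[OF test_fun_iter_partial[OF \<phi>]] is_weak_deriv_def)
qed

lemma weak_deriv_works:
  assumes "g \<in> L2 S" "is_weak_deriv S is u g"
  shows "weak_deriv S is u \<in> L2 S" "is_weak_deriv S is u (weak_deriv S is u)"
  using someI[of "\<lambda>g. g \<in> L2 S \<and> is_weak_deriv S is u g" g] assms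
  by (auto simp: weak_deriv_def)

text \<open>By uniqueness any square integrable weak derivative may stand in for the chosen one, so
  norms can be computed from convenient candidates.\<close>

lemma L2_norm_on_weak_deriv:
  assumes "open S" "g \<in> L2 S" "is_weak_deriv S is u g"
  shows "L2_norm_on S (weak_deriv S is u) = L2_norm_on S g"
  using assms weak_deriv_works[OF assms(2,3)]
  by (intro L2_norm_on_cong_AE is_weak_deriv_unique)

section \<open>Sobolev spaces and their norms\<close>

lemma sobolev_weak_deriv:
  assumes "u \<in> sobolev m S" "length is \<le> m"
  shows "weak_deriv S is u \<in> L2 S" "is_weak_deriv S is u (weak_deriv S is u)"
  using assms weak_deriv_works unfolding sobolev_def by blast+

lemma sobolev_L2: "u \<in> sobolev m S \<Longrightarrow> u \<in> L2 S"
  by (simp add: sobolev_def)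

lemma sobolev_mono: "u \<in> sobolev n S \<Longrightarrow> m \<le> n \<Longrightarrow> u \<in> sobolev m S"
  by (auto simp: sobolev_def)

lemma sobolev_add: "u \<in> sobolev m S \<Longrightarrow> v \<in> sobolev m S \<Longrightarrow> (\<lambda>x. u x + v x) \<in> sobolev m S"
  unfolding sobolev_def by (blast intro: L2_add is_weak_deriv_add)

lemma sobolev_scale: "u \<in> sobolev m S \<Longrightarrow> (\<lambda>x. a * u x) \<in> sobolev m S"
  unfolding sobolev_def by (blast intro: L2_scale is_weak_deriv_scale)

lemma sobolev_diff: "u \<in> sobolev m S \<Longrightarrow> v \<in> sobolev m S \<Longrightarrow> (\<lambda>x. u x - v x) \<in> sobolev m S"
  using sobolev_add[OF _ sobolev_scale, of u m S v "-1"] by simp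

lemma grad_norm_power2: "(grad_norm j S u)\<^sup>2 = (\<Sum>is | length is = j. (L2_norm_on S (weak_deriv S is u))\<^sup>2)"
  by (simp add: grad_norm_def sum_nonneg)

lemma grad_norm_add:
  assumes "open S" "u \<in> sobolev m S" "v \<in> sobolev m S" "j \<le> m"
  shows "(grad_norm j S (\<lambda>x. u x + v x))\<^sup>2 \<le> 2 * (grad_norm j S u)\<^sup>2 + 2 * (grad_norm j S v)\<^sup>2"
proof -
  have "(L2_norm_on S (weak_deriv S is (\<lambda>x. u x + v x)))\<^sup>2 \<le>
     2 * (L2_norm_on S (weak_deriv S is u))\<^sup>2 + 2 * (L2_norm_on S (weak_deriv S is v))\<^sup>2"
    if "length is = j" for "is"
  proof -
    note d = sobolev_weak_deriv[OF assms(2), of "is"] sobolev_weak_deriv[OF assms(3), of "is"]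
    \<comment> \<open>The derivative chosen for the sum need not be the sum of the chosen ones at
      every point, but the norms agree.\<close>
    have "L2_norm_on S (weak_deriv S is (\<lambda>x. u x + v x)) =
        L2_norm_on S (\<lambda>x. weak_deriv S is u x + weak_deriv S is v x)"
      using d that assms
      by (intro L2_norm_on_weak_deriv is_weak_deriv_add L2_add) (auto intro: sobolev_L2)
    then show ?thesis using d that assms(4) by (simp add: L2_norm_on_add)
  qed
  then have "(grad_norm j S (\<lambda>x. u x + v x))\<^sup>2 \<le> (\<Sum>is | length is = j.
     2 * (L2_norm_on S (weak_deriv S is u))\<^sup>2 + 2 * (L2_norm_on S (weak_deriv S is v))\<^sup>2)"
    unfolding grad_norm_power2 by (intro sum_mono) auto
  then show ?thesis by (simp add: grad_norm_power2 sum.distrib sum_distrib_left)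
qed

text \<open>A function is its own weak derivative of order 0, although \<open>weak_deriv\<close> may
  pick another representative.\<close>

lemma grad_norm_0:
  assumes "open S" "u \<in> L2 S"
  shows "grad_norm 0 S u = L2_norm_on S u"
proof -
  have "L2_norm_on S (weak_deriv S [] u) = L2_norm_on S u"
    using assms by (intro L2_norm_on_weak_deriv) (auto simp: is_weak_deriv_def)
  then show ?thesis by (simp add: grad_norm_def L2_norm_on_nonneg)
qed

lemma sobolev_norm_nonneg: "0 \<le> sobolev_norm m S u"
  by (simp add: sobolev_norm_def sum_nonneg)

lemma sobolev_norm_power2: "(sobolev_norm m S u)\<^sup>2 = (\<Sum>j\<le>m. (grad_norm j S u)\<^sup>2)"
  by (simp add: sobolev_norm_def sum_nonneg)

text \<open>Replaces the Minkowski inequality: a triangle inequality up to a constant is enough here.\<close>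

lemma le_double_sum_if_power2_le:
  fixes a b c :: real
  assumes "c\<^sup>2 \<le> 2 * a\<^sup>2 + 2 * b\<^sup>2" "0 \<le> a" "0 \<le> b"
  shows "c \<le> 2 * (a + b)"
proof (rule power2_le_imp_le)
  have "(2 * (a + b))\<^sup>2 = 4 * a\<^sup>2 + 4 * b\<^sup>2 + 8 * (a * b)"
    by (simp add: power2_eq_square algebra_simps)
  moreover have "0 \<le> a * b" "0 \<le> a\<^sup>2" "0 \<le> b\<^sup>2" using assms(2,3) by auto
  ultimately show "c\<^sup>2 \<le> (2 * (a + b))\<^sup>2" using assms(1) by linarith
qed (use assms in auto)

lemma sobolev_norm_add:
  assumes "open S" "u \<in> sobolev m S" "v \<in> sobolev m S"
  shows "sobolev_norm m S (\<lambda>x. u x + v x) \<le> 2 * (sobolev_norm m S u + sobolev_norm m S v)"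
proof (rule le_double_sum_if_power2_le)
  have "(\<Sum>j\<le>m. (grad_norm j S (\<lambda>x. u x + v x))\<^sup>2) \<le>
     (\<Sum>j\<le>m. 2 * (grad_norm j S u)\<^sup>2 + 2 * (grad_norm j S v)\<^sup>2)"
    using assms by (intro sum_mono grad_norm_add[of S u m v]) auto
  then show "(sobolev_norm m S (\<lambda>x. u x + v x))\<^sup>2 \<le> 2 * (sobolev_norm m S u)\<^sup>2 + 2 * (sobolev_norm m S v)\<^sup>2"
    by (simp add: sobolev_norm_power2 sum.distrib sum_distrib_left)
qed (rule sobolev_norm_nonneg)+

section \<open>Norms on a domain and norms summed over mesh elements\<close>

definition nonoverlapping_polytopes :: "(real^'n::finite) set set \<Rightarrow> bool" where
  "nonoverlapping_polytopes M \<longleftrightarrow> finite M \<and> (\<forall>T\<in>M. polytope T) \<and>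
     pairwise (\<lambda>T T'. interior T \<inter> interior T' = {}) M"

lemma polytope_frontier_null: "polytope (T::(real^'n::finite) set) \<Longrightarrow> frontier T \<in> null_sets lebesgue"
  using negligible_convex_frontier polytope_imp_convex negligible_iff_null_sets by blast

text \<open>The interior of the union exceeds the union of the interiors only by points on element
  frontiers, a null set. The interiors are disjoint, so the integral splits.\<close>

lemma L2_norm_on_Union:
  assumes M: "nonoverlapping_polytopes M" and u: "u \<in> L2 (interior (\<Union>M))"
  shows "(L2_norm_on (interior (\<Union>M)) u)\<^sup>2 = (\<Sum>T\<in>M. (L2_norm_on (interior T) u)\<^sup>2)"
proof -
  let ?A = "\<Union>T\<in>M. interior T"
  have sub: "?A \<subseteq> interior (\<Union>M)"
    by (intro UN_least interior_mono) auto
  have "(\<Union>T\<in>M. frontier T) \<in> null_sets lebesgue"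
    using M by (intro null_sets.finite_UN) (auto simp: nonoverlapping_polytopes_def polytope_frontier_null)
  moreover have "interior (\<Union>M) - ?A \<subseteq> (\<Union>T\<in>M. frontier T)"
  proof
    fix x assume x: "x \<in> interior (\<Union>M) - ?A"
    then obtain T where "T \<in> M" "x \<in> T" using interior_subset by blast
    moreover have "x \<in> closure T" using \<open>x \<in> T\<close> closure_subset by blast
    ultimately show "x \<in> (\<Union>T\<in>M. frontier T)" using x by (auto simp: frontier_def)
  qed
  ultimately have null: "interior (\<Union>M) - ?A \<in> null_sets lebesgue"
    by (meson null_sets_completion_subset)
  have uT: "u \<in> L2 (interior T)" if "T \<in> M" for T
    using u by (rule L2_subset) (use sub that in auto)
  have "(L2_norm_on (interior (\<Union>M)) u)\<^sup>2 = (L2_norm_on ?A u)\<^sup>2"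
    by (subst L2_norm_on_null_diff[OF u sub _ null]) (auto intro!: sets_completionI_sets borel_open open_UN)
  also have "\<dots> = (\<Sum>T\<in>M. (L2_norm_on (interior T) u)\<^sup>2)"
    unfolding L2_norm_on_power2
    using M uT
    by (intro set_integral_finite_Union)
      (auto simp: nonoverlapping_polytopes_def disjoint_family_on_def pairwise_def L2_def)
  finally show ?thesis .
qed

text \<open>A weak derivative on the whole domain restricts to one on each element, and uniqueness
  identifies the norms. This links the claim, stated on the active domain, with the inverse
  estimate, stated elementwise.\<close>

lemma sobolev_norm_eq_broken:
  assumes M: "nonoverlapping_polytopes M" and u: "u \<in> sobolev m (interior (\<Union>M))"
  shows "sobolev_norm m (interior (\<Union>M)) u = broken_sobolev_norm m M u"
proof -
  let ?S = "interior (\<Union>M)"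
  have "(grad_norm j ?S u)\<^sup>2 = (broken_grad_norm j M u)\<^sup>2" if "j \<le> m" for j
  proof -
    have d: "weak_deriv ?S is u \<in> L2 ?S" "is_weak_deriv ?S is u (weak_deriv ?S is u)"
      if "length is = j" for "is"
      using sobolev_weak_deriv[OF u, of "is"] that \<open>j \<le> m\<close> by auto
    have "(L2_norm_on ?S (weak_deriv ?S is u))\<^sup>2 = (\<Sum>T\<in>M. (L2_norm_on (interior T) (weak_deriv (interior T) is u))\<^sup>2)"
      if "length is = j" for "is"
    proof -
      have "L2_norm_on (interior T) (weak_deriv (interior T) is u) = L2_norm_on (interior T) (weak_deriv ?S is u)"
        if "T \<in> M" for T
      proof -
        have "interior T \<subseteq> ?S" using that by (intro interior_mono) auto
        then show ?thesis
          using d[OF \<open>length is = j\<close>]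
          by (intro L2_norm_on_weak_deriv) (auto intro: L2_subset is_weak_deriv_subset)
      qed
      then show ?thesis using L2_norm_on_Union[OF M d(1)[OF that]] by simp
    qed
    then have "(grad_norm j ?S u)\<^sup>2 =
       (\<Sum>is | length is = j. \<Sum>T\<in>M. (L2_norm_on (interior T) (weak_deriv (interior T) is u))\<^sup>2)"
      unfolding grad_norm_power2 by (intro sum.cong) auto
    also have "\<dots> = (\<Sum>T\<in>M. (grad_norm j (interior T) u)\<^sup>2)"
      unfolding grad_norm_power2 by (rule sum.swap)
    finally show ?thesis by (simp add: broken_grad_norm_def sum_nonneg)
  qed
  then show ?thesis by (simp add: sobolev_norm_def broken_sobolev_norm_def)
qed

section \<open>Piecewise polynomials and the discrete extension\<close>

text \<open>Lebesgue measure is complete, and preimages under \<open>f\<close> and \<open>g\<close>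
  agree almost everywhere.\<close>

lemma borel_measurable_lebesgue_cong_AE:
  fixes f g :: "'a::euclidean_space \<Rightarrow> 'b::topological_space"
  assumes "f \<in> borel_measurable lebesgue" "AE x in lebesgue. f x = g x"
  shows "g \<in> borel_measurable lebesgue"
proof (rule measurableI)
  fix B :: "'b set" assume "B \<in> sets borel"
  then have "f -` B \<inter> space lebesgue \<in> sets lebesgue"
    using assms(1) by (rule measurable_sets[rotated])
  then show "g -` B \<inter> space lebesgue \<in> sets lebesgue"
    by (rule completion.in_sets_AE[rotated]) (use assms(2) in \<open>auto elim!: eventually_mono\<close>)
qed simp

text \<open>Serves to pass from the interior of an element to the closed element.\<close>

lemma L2_null_extend:
  assumes "u \<in> L2 A" "A \<subseteq> S" "S - A \<in> null_sets lebesgue"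
  shows "u \<in> L2 S"
proof -
  have ae: "AE x in lebesgue. indicator A x *\<^sub>R f x = indicator S x *\<^sub>R f x" for f :: "_ \<Rightarrow> real"
    using AE_not_in[OF assms(3)] by eventually_elim (use assms(2) in \<open>auto simp: indicator_def\<close>)
  have m: "(\<lambda>x. indicator S x *\<^sub>R f x) \<in> borel_measurable lebesgue"
    if "(\<lambda>x. indicator A x *\<^sub>R f x) \<in> borel_measurable lebesgue" for f :: "_ \<Rightarrow> real"
    using that ae by (rule borel_measurable_lebesgue_cong_AE)
  have "integrable lebesgue (\<lambda>x. indicator S x *\<^sub>R (u x)\<^sup>2)"
    using assms(1) by (intro integrable_cong_AE_imp[OF _ m])
      (auto simp: L2_def set_integrable_def intro: eventually_mono[OF ae] borel_measurable_integrable)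
  then show ?thesis
    using assms(1) m[of u] by (simp add: L2_def set_borel_measurable_def set_integrable_def)
qed

lemma L2_cong:
  assumes "\<And>x. x \<in> S \<Longrightarrow> u x = v x"
  shows "u \<in> L2 S \<longleftrightarrow> v \<in> L2 S"
proof -
  have "(\<lambda>x. indicator S x *\<^sub>R u x) = (\<lambda>x. indicator S x *\<^sub>R v x)"
    "(\<lambda>x. indicator S x *\<^sub>R (u x)\<^sup>2) = (\<lambda>x. indicator S x *\<^sub>R (v x)\<^sup>2)"
    using assms by (auto simp: indicator_def)
  then show ?thesis unfolding L2_def set_borel_measurable_def set_integrable_def by simp
qed

lemma L2_norm_on_cong:
  assumes "\<And>x. x \<in> S \<Longrightarrow> u x = v x"
  shows "L2_norm_on S u = L2_norm_on S v"
  unfolding L2_norm_on_def set_lebesgue_integral_def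
  by (intro arg_cong[where f = sqrt] Bochner_Integration.integral_cong) (auto simp: indicator_def assms)

lemma polytope_diff_interior_null:
  assumes "polytope (T::(real^'n::finite) set)"
  shows "T - interior T \<in> null_sets lebesgue"
  by (rule null_sets_completion_subset[OF _ polytope_frontier_null[OF assms]])
    (use closure_subset[of T] in \<open>auto simp: frontier_def\<close>)

section \<open>Elementwise norms of order zero\<close>

lemma broken_grad_norm_nonneg: "0 \<le> broken_grad_norm j M u"
  by (simp add: broken_grad_norm_def sum_nonneg)

lemma broken_sobolev_norm_0: "broken_sobolev_norm 0 M u = broken_grad_norm 0 M u"
  by (simp add: broken_sobolev_norm_def broken_grad_norm_nonneg)

lemma broken_grad_norm_0_power2:
  assumes "\<And>T. T \<in> M \<Longrightarrow> u \<in> L2 (interior T)"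
  shows "(broken_grad_norm 0 M u)\<^sup>2 = (\<Sum>T\<in>M. (L2_norm_on (interior T) u)\<^sup>2)"
  using assms by (simp add: broken_grad_norm_def sum_nonneg grad_norm_0)

text \<open>\<open>broken_L2_norm\<close> integrates over closed elements,
  \<open>broken_grad_norm\<close> over their interiors; the difference is null.\<close>

lemma broken_L2_norm_eq_grad_norm_0:
  assumes "nonoverlapping_polytopes M" "\<And>T. T \<in> M \<Longrightarrow> u \<in> L2 (interior T)"
  shows "broken_L2_norm M u = broken_grad_norm 0 M u"
proof -
  have "L2_norm_on T u = grad_norm 0 (interior T) u" if "T \<in> M" for T
  proof -
    have T: "T - interior T \<in> null_sets lebesgue"
      using assms(1) that by (auto simp: nonoverlapping_polytopes_def polytope_diff_interior_null)
    have "u \<in> L2 T"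
      using assms(2)[OF that] interior_subset T by (rule L2_null_extend)
    from L2_norm_on_null_diff[OF this interior_subset _ T] show ?thesis
      using assms(2)[OF that] by (simp add: grad_norm_0)
  qed
  then show ?thesis by (simp add: broken_L2_norm_def broken_grad_norm_def)
qed

lemma broken_grad_norm_0_diff:
  assumes "\<And>T. T \<in> M \<Longrightarrow> u \<in> L2 (interior T)" "\<And>T. T \<in> M \<Longrightarrow> v \<in> L2 (interior T)"
  shows "broken_grad_norm 0 M (\<lambda>x. u x - v x) \<le> 2 * (broken_grad_norm 0 M u + broken_grad_norm 0 M v)"
proof (rule le_double_sum_if_power2_le)
  have "(L2_norm_on (interior T) (\<lambda>x. u x - v x))\<^sup>2
      \<le> 2 * (L2_norm_on (interior T) u)\<^sup>2 + 2 * (L2_norm_on (interior T) v)\<^sup>2" if "T \<in> M" for T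
  proof -
    have "L2_norm_on (interior T) (\<lambda>x. - 1 * v x) = L2_norm_on (interior T) v"
      by (simp add: L2_norm_on_def)
    then show ?thesis
      using L2_norm_on_add[OF assms(1)[OF that] L2_scale[OF assms(2)[OF that], of "- 1"]] by simp
  qed
  then show "(broken_grad_norm 0 M (\<lambda>x. u x - v x))\<^sup>2
      \<le> 2 * (broken_grad_norm 0 M u)\<^sup>2 + 2 * (broken_grad_norm 0 M v)\<^sup>2"
    using assms by (simp add: broken_grad_norm_0_power2 L2_diff sum_distrib_left sum_mono flip: sum.distrib)
qed (rule broken_grad_norm_nonneg)+

section \<open>Polynomials and piecewise polynomials\<close>

lemma poly_fun_continuous: "poly_fun k p \<Longrightarrow> continuous_on UNIV p"
proof -
  assume "poly_fun k p"
  then obtain c where p: "p = (\<lambda>x. \<Sum>\<alpha> | sum \<alpha> UNIV \<le> k. c \<alpha> * (\<Prod>i\<in>UNIV. (x $ i) ^ \<alpha> i))"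
    unfolding poly_fun_def by blast
  show ?thesis unfolding p by (intro continuous_intros)
qed

lemma poly_fun_add:
  assumes "poly_fun k p" "poly_fun k q"
  shows "poly_fun k (\<lambda>x. p x + q x)"
proof -
  obtain c d where "\<And>x. p x = (\<Sum>\<alpha> | sum \<alpha> UNIV \<le> k. c \<alpha> * (\<Prod>i\<in>UNIV. (x $ i) ^ \<alpha> i))"
    "\<And>x. q x = (\<Sum>\<alpha> | sum \<alpha> UNIV \<le> k. d \<alpha> * (\<Prod>i\<in>UNIV. (x $ i) ^ \<alpha> i))"
    using assms unfolding poly_fun_def by blast
  then show ?thesis unfolding poly_fun_def
    by (intro exI[of _ "\<lambda>\<alpha>. c \<alpha> + d \<alpha>"]) (simp add: distrib_right sum.distrib)
qed

lemma poly_fun_scale: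
  assumes "poly_fun k p"
  shows "poly_fun k (\<lambda>x. a * p x)"
proof -
  obtain c where "\<And>x. p x = (\<Sum>\<alpha> | sum \<alpha> UNIV \<le> k. c \<alpha> * (\<Prod>i\<in>UNIV. (x $ i) ^ \<alpha> i))"
    using assms unfolding poly_fun_def by blast
  then show ?thesis unfolding poly_fun_def
    by (intro exI[of _ "\<lambda>\<alpha>. a * c \<alpha>"]) (simp add: sum_distrib_left mult.assoc)
qed

lemma poly_fun_zero: "poly_fun k (\<lambda>x. 0)"
  unfolding poly_fun_def by (intro exI[of _ "\<lambda>\<alpha>. 0"]) simp

lemma broken_polyD:
  "w \<in> broken_poly k M \<Longrightarrow> T \<in> M \<Longrightarrow> \<exists>p. poly_fun k p \<and> (\<forall>x\<in>interior T. w x = p x)"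
  by (simp add: broken_poly_def)

lemma fun_subspace_broken_poly: "fun_subspace (broken_poly k M)"
  unfolding fun_subspace_def
proof (intro conjI ballI allI)
  show "(\<lambda>x. 0) \<in> broken_poly k M"
    using poly_fun_zero[of k] unfolding broken_poly_def by blast
next
  fix u v assume uv: "u \<in> broken_poly k M" "v \<in> broken_poly k M"
  have "\<exists>p. poly_fun k p \<and> (\<forall>x\<in>interior T. u x + v x = p x)" if T: "T \<in> M" for T
  proof -
    obtain p q where "poly_fun k p" "\<forall>x\<in>interior T. u x = p x" "poly_fun k q" "\<forall>x\<in>interior T. v x = q x"
      using broken_polyD[OF uv(1) T] broken_polyD[OF uv(2) T] by metis
    then show ?thesis by (intro exI[of _ "\<lambda>x. p x + q x"]) (simp add: poly_fun_add)
  qed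
  then show "(\<lambda>x. u x + v x) \<in> broken_poly k M" using uv by (simp add: broken_poly_def)
next
  fix a u assume u: "u \<in> broken_poly k M"
  have "\<exists>p. poly_fun k p \<and> (\<forall>x\<in>interior T. a * u x = p x)" if T: "T \<in> M" for T
  proof -
    obtain p where "poly_fun k p" "\<forall>x\<in>interior T. u x = p x"
      using broken_polyD[OF u T] by metis
    then show ?thesis by (intro exI[of _ "\<lambda>x. a * p x"]) (simp add: poly_fun_scale)
  qed
  then show "(\<lambda>x. a * u x) \<in> broken_poly k M" using u by (simp add: broken_poly_def)
qed

lemma broken_poly_L2:
  assumes "w \<in> broken_poly k M" "T \<in> M" "polytope T"
  shows "w \<in> L2 (interior T)"
proof -
  obtain p where p: "poly_fun k p" "\<And>x. x \<in> interior T \<Longrightarrow> w x = p x"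
    using broken_polyD[OF assms(1,2)] by metis
  have "p \<in> L2 (interior T)"
    by (rule continuous_in_L2_compact[OF poly_fun_continuous[OF p(1)] polytope_imp_compact[OF assms(3)] interior_subset])
      simp
  then show ?thesis using L2_cong[of "interior T" w p] p(2) by simp
qed

section \<open>Function spaces and linear operators\<close>

lemma fun_subspace_add: "fun_subspace V \<Longrightarrow> u \<in> V \<Longrightarrow> v \<in> V \<Longrightarrow> (\<lambda>x. u x + v x) \<in> V"
  and fun_subspace_scale: "fun_subspace V \<Longrightarrow> u \<in> V \<Longrightarrow> (\<lambda>x. a * u x) \<in> V"
  by (simp_all add: fun_subspace_def)

lemma fun_subspace_diff:
  assumes "fun_subspace V" "u \<in> V" "v \<in> V"
  shows "(\<lambda>x. u x - v x) \<in> V"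
  using fun_subspace_add[OF assms(1,2) fun_subspace_scale[OF assms(1,3), of "- 1"]] by simp

lemma linear_map_between_diff:
  assumes "linear_map_between U V L" "fun_subspace U" "u \<in> U" "v \<in> U"
  shows "L (\<lambda>x. u x - v x) = (\<lambda>x. L u x - L v x)"
proof -
  have add: "L (\<lambda>x. u x + w x) = (\<lambda>x. L u x + L w x)" if "w \<in> U" for w
    using assms(1,3) that by (simp add: linear_map_between_def)
  have scale: "L (\<lambda>x. a * v x) = (\<lambda>x. a * L v x)" for a
    using assms(1,4) by (simp add: linear_map_between_def)
  show ?thesis
    using add[OF fun_subspace_scale[OF assms(2,4), of "- 1"]] scale[of "- 1"] by simp
qed

text \<open>Restriction commutes with sums and multiples. The result lets \<open>Fh\<close> be
  applied to differences by linearity.\<close>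

lemma fun_subspace_WhI: "fun_subspace (WhI k c)"
proof -
  have W: "fun_subspace (Wh k c)" unfolding Wh_def by (rule fun_subspace_broken_poly)
  have r: "(\<lambda>x. restr_I c u x + restr_I c v x) = restr_I c (\<lambda>x. u x + v x)"
    "(\<lambda>x. a * restr_I c u x) = restr_I c (\<lambda>x. a * u x)" "(\<lambda>x. 0) = restr_I c (\<lambda>x. 0)" for u v a
    by (auto simp: restr_I_def mesh_restrict_def)
  show ?thesis
    unfolding fun_subspace_def
  proof (intro conjI ballI allI)
    have "(\<lambda>x. 0) \<in> Wh k c" using W by (simp add: fun_subspace_def)
    then show "(\<lambda>x. 0) \<in> WhI k c" unfolding WhI_def by (subst r(3)) (rule imageI)
  next
    fix u v assume "u \<in> WhI k c" "v \<in> WhI k c"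
    then obtain u' v' where "u = restr_I c u'" "u' \<in> Wh k c" "v = restr_I c v'" "v' \<in> Wh k c"
      unfolding WhI_def by blast
    then show "(\<lambda>x. u x + v x) \<in> WhI k c"
      unfolding WhI_def by (simp only: r(1)) (intro imageI fun_subspace_add W)
  next
    fix a u assume "u \<in> WhI k c"
    then obtain u' where "u = restr_I c u'" "u' \<in> Wh k c"
      unfolding WhI_def by blast
    then show "(\<lambda>x. a * u x) \<in> WhI k c"
      unfolding WhI_def by (simp only: r(2)) (intro imageI fun_subspace_scale W)
  qed
qed

lemma restr_I_diff: "restr_I c (\<lambda>x. u x - v x) = (\<lambda>x. restr_I c u x - restr_I c v x)"
  by (auto simp: restr_I_def mesh_restrict_def)

text \<open>The extension operator reproduces \<open>W\<^sub>h\<^sup>E\<close>, so its defect on \<open>u\<close> only sees the distance of \<open>u\<close>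
  to \<open>W\<^sub>h\<^sup>E\<close>: with \<open>e = w - u\<close> one has \<open>u - F\<^sub>h(u)\<^sub>I = F\<^sub>h(e)\<^sub>I - e\<close>.\<close>

lemma extension_defect:
  assumes c: "cutfem_setting k l c" and u: "u \<in> Wh k c" and w: "w \<in> WhE k c"
    and F: "Fh c (restr_I c w) = w" and C: "C \<ge> 0"
    and stab: "\<And>w. w \<in> WhI k c \<Longrightarrow>
      broken_grad_norm 0 (active_mesh c) (Fh c w) \<le> C * broken_grad_norm 0 (interior_mesh c) w"
  shows "broken_grad_norm 0 (active_mesh c) (\<lambda>x. u x - Fh c (restr_I c u) x)
    \<le> 2 * (C + 1) * broken_grad_norm 0 (active_mesh c) (\<lambda>x. w x - u x)"
proof -
  let ?e = "\<lambda>x. w x - u x"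
  have Fl: "linear_map_between (WhI k c) (Wh k c) (Fh c)"
    and mesh: "is_mesh (bg_mesh c) (bg_dom c)"
    using c by (simp_all add: cutfem_setting_def)
  have poly: "polytope T" if "T \<in> active_mesh c" for T
    using mesh that by (auto simp: is_mesh_def active_mesh_def)
  have fin: "finite (active_mesh c)" using mesh by (auto simp: is_mesh_def active_mesh_def)
  have sub: "interior_mesh c \<subseteq> active_mesh c" by (auto simp: interior_mesh_def)
  have WL: "z \<in> L2 (interior T)" if "z \<in> Wh k c" "T \<in> active_mesh c" for z T
    using broken_poly_L2 that poly unfolding Wh_def by blast
  have W: "fun_subspace (Wh k c)" unfolding Wh_def by (rule fun_subspace_broken_poly)
  have wW: "w \<in> Wh k c" using w Fl unfolding WhE_def linear_map_between_def by auto
  have e: "?e \<in> Wh k c" using W wW u by (rule fun_subspace_diff)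
  have I: "restr_I c z \<in> WhI k c" if "z \<in> Wh k c" for z using that by (simp add: WhI_def)
  have Fe: "Fh c (restr_I c ?e) = (\<lambda>x. w x - Fh c (restr_I c u) x)"
    unfolding restr_I_diff using linear_map_between_diff[OF Fl fun_subspace_WhI I[OF wW] I[OF u]] F by simp
  then have "(\<lambda>x. u x - Fh c (restr_I c u) x) = (\<lambda>x. Fh c (restr_I c ?e) x - ?e x)"
    by auto
  moreover have "Fh c (restr_I c ?e) \<in> Wh k c"
    using Fl I[OF e] by (auto simp: linear_map_between_def)
  ultimately have "broken_grad_norm 0 (active_mesh c) (\<lambda>x. u x - Fh c (restr_I c u) x)
     \<le> 2 * (broken_grad_norm 0 (active_mesh c) (Fh c (restr_I c ?e)) + broken_grad_norm 0 (active_mesh c) ?e)"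
    using broken_grad_norm_0_diff[of "active_mesh c" "Fh c (restr_I c ?e)" ?e] WL e by simp
  \<comment> \<open>Restriction leaves \<open>?e\<close> unchanged on interior elements, and the sum
    over these is part of the sum over all active ones.\<close>
  moreover have "broken_grad_norm 0 (interior_mesh c) (restr_I c ?e) \<le> broken_grad_norm 0 (active_mesh c) ?e"
  proof (rule power2_le_imp_le)
    have eq: "restr_I c ?e x = ?e x" if "x \<in> interior T" "T \<in> interior_mesh c" for x T
      using that by (auto simp: restr_I_def mesh_restrict_def)
    have eL: "?e \<in> L2 (interior T)" if "T \<in> active_mesh c" for T using WL[OF e that] .
    have "restr_I c ?e \<in> L2 (interior T)" if "T \<in> interior_mesh c" for T
      using L2_cong[of "interior T" "restr_I c ?e" ?e] eq[OF _ that] eL[of T] that sub by blast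
    then have "(broken_grad_norm 0 (interior_mesh c) (restr_I c ?e))\<^sup>2
        = (\<Sum>T\<in>interior_mesh c. (L2_norm_on (interior T) (restr_I c ?e))\<^sup>2)"
      by (rule broken_grad_norm_0_power2)
    also have "\<dots> = (\<Sum>T\<in>interior_mesh c. (L2_norm_on (interior T) ?e)\<^sup>2)"
      by (intro sum.cong refl arg_cong[where f = "\<lambda>x. x\<^sup>2"] L2_norm_on_cong eq)
    also have "\<dots> \<le> (\<Sum>T\<in>active_mesh c. (L2_norm_on (interior T) ?e)\<^sup>2)"
      using fin sub by (intro sum_mono2) auto
    also have "\<dots> = (broken_grad_norm 0 (active_mesh c) ?e)\<^sup>2"
      using eL by (rule broken_grad_norm_0_power2[symmetric])
    finally show "(broken_grad_norm 0 (interior_mesh c) (restr_I c ?e))\<^sup>2 \<le> (broken_grad_norm 0 (active_mesh c) ?e)\<^sup>2" .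
  qed (rule broken_grad_norm_nonneg)
  then have "C * broken_grad_norm 0 (interior_mesh c) (restr_I c ?e) \<le> C * broken_grad_norm 0 (active_mesh c) ?e"
    using C by (rule mult_left_mono)
  ultimately show ?thesis
    using stab[OF I[OF e]] by (simp add: algebra_simps)
qed

section \<open>The approximation property of the discrete extension\<close>

lemma sobolev_real_subset:
  assumes "v \<in> sobolev_real s S" "real m \<le> s"
  shows "v \<in> sobolev m S"
proof -
  have "m \<le> nat \<lfloor>s\<rfloor>" using assms(2) by (simp add: le_nat_floor)
  then show ?thesis using assms(1) by (auto simp: sobolev_real_def intro: sobolev_mono)
qed

theorem lemma2p2:
  fixes \<F> :: "'n::finite cutfem set" and k l :: nat and h0 s :: real
  assumes "0 < h0"
    and "cutfem_family k l h0 \<F>"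
    and "0 \<le> s" and "s \<le> real k + 1"
    and "assm_A1 k \<F>"
    and "assm_A2 k l s \<F>"
    and "assm_A3 k \<F>"
    and "assm_A4 k l \<F>"
  shows "\<exists>C>0. \<forall>c\<in>\<F>. \<forall>v\<in>sobolev_real s (active_dom c).
           \<exists>vE\<in>VhE c. \<forall>m::nat. m \<le> l \<and> real m \<le> s \<longrightarrow>
             sobolev_norm m (active_dom c) (\<lambda>x. v x - vE x)
               \<le> C * (hpar c powr (s - real m) * sobolev_real_seminorm s (active_dom c) v)"
proof -
  obtain C1 where C1: "\<And>m. C1 m > 0" "\<And>m c w. c \<in> \<F> \<Longrightarrow> w \<in> Wh k c \<Longrightarrow>
      broken_sobolev_norm m (active_mesh c) w \<le> C1 m * (hpar c powr (- real m) * broken_L2_norm (active_mesh c) w)"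
    using assms(5) unfolding assm_A1_def by metis
  \<comment> \<open>A1 has one constant per order; the sum dominates those of all orders up to
    \<open>l\<close>, so that the final constant is independent of \<open>m\<close>.\<close>
  define D1 where "D1 = (\<Sum>m\<le>l. C1 m)"
  have D1: "C1 m \<le> D1" if "m \<le> l" for m
    unfolding D1_def using that C1(1) by (intro member_le_sum) (auto intro: less_imp_le)
  have D1_pos: "D1 > 0" using D1[of 0] C1(1)[of 0] by simp
  obtain C2 where C2: "C2 > 0" "\<And>c v. c \<in> \<F> \<Longrightarrow> v \<in> sobolev_real s (active_dom c) \<Longrightarrow>
     \<exists>vs\<in>Vh c. \<exists>ws\<in>WhE k c. \<forall>m::nat. m \<le> l \<and> real m \<le> s \<longrightarrow>
          sobolev_norm m (active_dom c) (\<lambda>x. v x - vs x)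
            \<le> C2 * (hpar c powr (s - real m) * sobolev_real_seminorm s (active_dom c) v) \<and>
          broken_sobolev_norm m (active_mesh c) (\<lambda>x. v x - ws x)
            \<le> C2 * (hpar c powr (s - real m) * sobolev_real_seminorm s (active_dom c) v)"
    using assms(6) unfolding assm_A2_def by meson
  obtain C3 where C3: "C3 > 0" "\<And>c v. c \<in> \<F> \<Longrightarrow> v \<in> Wh k c \<Longrightarrow>
     broken_L2_norm (active_mesh c) (Ah c v) \<le> C3 * broken_L2_norm (active_mesh c) v"
    and A_proj: "\<And>c v. c \<in> \<F> \<Longrightarrow> v \<in> Vh c \<Longrightarrow> Ah c v = v"
    using assms(7) unfolding assm_A3_def by meson
  obtain C4 where C4: "C4 > 0" "\<And>c w. c \<in> \<F> \<Longrightarrow> w \<in> WhI k c \<Longrightarrow>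
      broken_grad_norm 0 (active_mesh c) (Fh c w) \<le> C4 * broken_grad_norm 0 (interior_mesh c) w"
    and F_proj: "\<And>c w. c \<in> \<F> \<Longrightarrow> w \<in> WhE k c \<Longrightarrow> Fh c (restr_I c w) = w"
    using assms(8) unfolding assm_A4_def by (meson le0)
  \<comment> \<open>The first summand comes from \<open>v - vs\<close>, the second from
    \<open>vs - vE\<close>: A1, A3 and \<open>extension_defect\<close> give 8 * D1 * C3 * (C4 + 1) *
    C2, where 8 is 2 from the defect times 4 from comparing \<open>ws\<close> with
    \<open>vs\<close>. The last triangle inequality doubles both.\<close>
  define C where "C = 2 * C2 + 16 * D1 * C3 * (C4 + 1) * C2"
  have "C > 0"
    unfolding C_def using C2(1) D1_pos C3(1) C4(1) by (intro add_pos_pos mult_pos_pos) auto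
  moreover have "\<exists>vE\<in>VhE c. \<forall>m::nat. m \<le> l \<and> real m \<le> s \<longrightarrow>
             sobolev_norm m (active_dom c) (\<lambda>x. v x - vE x)
               \<le> C * (hpar c powr (s - real m) * sobolev_real_seminorm s (active_dom c) v)"
    if c: "c \<in> \<F>" and v: "v \<in> sobolev_real s (active_dom c)" for c v
  proof -
    let ?M = "active_mesh c" and ?S = "active_dom c" and ?h = "hpar c"
    \<comment> \<open>This is the bound of A2 for \<open>m = 0\<close>, up to
      \<open>C2\<close>.\<close>
    let ?X = "?h powr s * sobolev_real_seminorm s ?S v"
    have setting: "cutfem_setting k l c" and h: "?h > 0"
      using assms(2) c by (auto simp: cutfem_family_def)
    then have V: "fun_subspace (Vh c)" "Vh c \<subseteq> Wh k c" "Vh c \<subseteq> sobolev l ?S"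
      and Al: "linear_map_between (Wh k c) (Vh c) (Ah c)"
      and Fl: "linear_map_between (WhI k c) (Wh k c) (Fh c)"
      and mesh: "is_mesh (bg_mesh c) (bg_dom c)"
      by (auto simp: cutfem_setting_def)
    have M: "nonoverlapping_polytopes ?M"
      using mesh by (auto simp: is_mesh_def nonoverlapping_polytopes_def active_mesh_def pairwise_def)
    have S: "?S = interior (\<Union>?M)" "open ?S" by (simp_all add: active_dom_def)
    have W: "fun_subspace (Wh k c)" unfolding Wh_def by (rule fun_subspace_broken_poly)
    have WL: "z \<in> L2 (interior T)" if "z \<in> Wh k c" "T \<in> ?M" for z T
      using broken_poly_L2[of z k ?M T] that M by (auto simp: Wh_def nonoverlapping_polytopes_def)
    have W_L2: "broken_L2_norm ?M z = broken_grad_norm 0 ?M z" if "z \<in> Wh k c" for z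
      using M WL[OF that] by (rule broken_L2_norm_eq_grad_norm_0)
    obtain vs ws where vs: "vs \<in> Vh c" and ws: "ws \<in> WhE k c"
      and approx: "\<And>m. m \<le> l \<Longrightarrow> real m \<le> s \<Longrightarrow> sobolev_norm m ?S (\<lambda>x. v x - vs x)
            \<le> C2 * (?h powr (s - real m) * sobolev_real_seminorm s ?S v)"
        "\<And>m. m \<le> l \<Longrightarrow> real m \<le> s \<Longrightarrow> broken_sobolev_norm m ?M (\<lambda>x. v x - ws x)
            \<le> C2 * (?h powr (s - real m) * sobolev_real_seminorm s ?S v)"
      using C2(2)[OF c v] by blast
    have vsW: "vs \<in> Wh k c" using vs V by auto
    have wsW: "ws \<in> Wh k c" using ws Fl unfolding WhE_def linear_map_between_def by auto
    let ?Fv = "Fh c (restr_I c vs)"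
    let ?d = "\<lambda>x. vs x - ?Fv x"
    \<comment> \<open>The witness is fixed before \<open>m\<close>, so one function serves all
      orders, as \<open>vs\<close> and \<open>ws\<close> do.\<close>
    define vE where "vE = Ah c ?Fv"
    have FvW: "?Fv \<in> Wh k c"
      using Fl vsW by (auto simp: linear_map_between_def WhI_def)
    have dW: "?d \<in> Wh k c" using W vsW FvW by (rule fun_subspace_diff)
    have vE_in: "vE \<in> VhE c" "vE \<in> Vh c"
      using vs Al FvW by (auto simp: vE_def VhE_def VhI_def Eh_def linear_map_between_def)
    have diff: "(\<lambda>x. vs x - vE x) = Ah c ?d"
      using linear_map_between_diff[OF Al W vsW FvW] A_proj[OF c vs] by (simp add: vE_def)
    have diff_V: "(\<lambda>x. vs x - vE x) \<in> Vh c"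
      using V(1) vs vE_in(2) by (rule fun_subspace_diff)
    have v0: "v \<in> sobolev 0 ?S" using v assms(3) by (intro sobolev_real_subset) auto
    have vL: "v \<in> L2 (interior T)" if "T \<in> ?M" for T
      using sobolev_L2[OF v0] by (rule L2_subset) (use that in \<open>auto simp: S(1) intro!: interior_mono\<close>)
    \<comment> \<open>A2 measures \<open>v - vs\<close> on the active domain but
      \<open>v - ws\<close> elementwise; this brings the first into the form of the second.\<close>
    have "broken_grad_norm 0 ?M (\<lambda>x. v x - vs x) = sobolev_norm 0 ?S (\<lambda>x. v x - vs x)"
    proof -
      have "(\<lambda>x. v x - vs x) \<in> sobolev 0 (interior (\<Union>?M))"
        using v0 vs V(3) unfolding S(1)[symmetric] by (intro sobolev_diff) (auto intro: sobolev_mono)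
      from sobolev_norm_eq_broken[OF M this] show ?thesis by (simp add: broken_sobolev_norm_0 S(1))
    qed
    \<comment> \<open>Subtracting the two errors cancels \<open>v\<close>. Each is at most
      \<open>C2 * ?X\<close>, and the factor 2 makes the constant \<open>4 * C2\<close>.\<close>
    moreover have "broken_grad_norm 0 ?M (\<lambda>x. (v x - vs x) - (v x - ws x)) \<le>
        2 * (broken_grad_norm 0 ?M (\<lambda>x. v x - vs x) + broken_grad_norm 0 ?M (\<lambda>x. v x - ws x))"
      by (intro broken_grad_norm_0_diff L2_diff vL WL vsW wsW)
    ultimately have "broken_grad_norm 0 ?M (\<lambda>x. ws x - vs x) \<le> 4 * C2 * ?X"
      using approx[of 0] assms(3) by (simp add: broken_sobolev_norm_0)
    then have "2 * (C4 + 1) * broken_grad_norm 0 ?M (\<lambda>x. ws x - vs x) \<le> 2 * (C4 + 1) * (4 * C2 * ?X)"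
      using C4(1) by (intro mult_left_mono) auto
    moreover have "2 * (C4 + 1) * (4 * C2 * ?X) = 8 * (C4 + 1) * C2 * ?X"
      by (simp add: algebra_simps)
    ultimately have d: "broken_grad_norm 0 ?M ?d \<le> 8 * (C4 + 1) * C2 * ?X"
      using extension_defect[OF setting vsW ws F_proj[OF c ws] less_imp_le[OF C4(1)] C4(2)[OF c]] by linarith
    have L2_bound: "broken_L2_norm ?M (\<lambda>x. vs x - vE x) \<le> C3 * (8 * (C4 + 1) * C2 * ?X)"
    proof -
      have "broken_L2_norm ?M (\<lambda>x. vs x - vE x) \<le> C3 * broken_grad_norm 0 ?M ?d"
        unfolding diff using C3(2)[OF c dW] W_L2[OF dW] by simp
      also have "\<dots> \<le> C3 * (8 * (C4 + 1) * C2 * ?X)"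
        using d C3(1) by (intro mult_left_mono) auto
      finally show ?thesis .
    qed
    have "sobolev_norm m ?S (\<lambda>x. v x - vE x) \<le> C * (?h powr (s - real m) * sobolev_real_seminorm s ?S v)"
      if m: "m \<le> l" "real m \<le> s" for m
    proof -
      let ?Y = "?h powr (s - real m) * sobolev_real_seminorm s ?S v"
      have Vm: "z \<in> sobolev m ?S" if "z \<in> Vh c" for z
        using that V(3) m(1) sobolev_mono by blast
      \<comment> \<open>The negative power of \<open>h\<close> lost in the inverse estimate combines
        with the full order \<open>s\<close> gained in L2.\<close>
      have powr: "?h powr (- real m) * ?X = ?Y"
        by (simp add: powr_add[symmetric] mult.assoc[symmetric])
      \<comment> \<open>Both functions lie in \<open>Vh\<close>, hence have weak derivatives across
        element boundaries, and the elementwise inverse estimate becomes available.\<close>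
      have "sobolev_norm m ?S (\<lambda>x. vs x - vE x) = broken_sobolev_norm m ?M (\<lambda>x. vs x - vE x)"
        using sobolev_norm_eq_broken[OF M] Vm[OF diff_V] by (simp add: S(1))
      also have "\<dots> \<le> C1 m * (?h powr (- real m) * broken_L2_norm ?M (\<lambda>x. vs x - vE x))"
        using C1(2)[OF c] diff_V V(2) by blast
      also have "\<dots> \<le> D1 * (?h powr (- real m) * broken_L2_norm ?M (\<lambda>x. vs x - vE x))"
        using D1[OF m(1)] by (intro mult_right_mono mult_nonneg_nonneg) (auto simp: broken_L2_norm_def sum_nonneg)
      also have "\<dots> \<le> D1 * (?h powr (- real m) * (C3 * (8 * (C4 + 1) * C2 * ?X)))"
        using L2_bound D1_pos by (intro mult_left_mono) auto
      also have "\<dots> = 8 * D1 * C3 * (C4 + 1) * C2 * ?Y"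
        unfolding powr[symmetric] by (simp only: mult_ac)
      finally have "sobolev_norm m ?S (\<lambda>x. vs x - vE x) \<le> 8 * D1 * C3 * (C4 + 1) * C2 * ?Y" .
      moreover have "sobolev_norm m ?S (\<lambda>x. (v x - vs x) + (vs x - vE x)) \<le>
          2 * (sobolev_norm m ?S (\<lambda>x. v x - vs x) + sobolev_norm m ?S (\<lambda>x. vs x - vE x))"
        using S(2) sobolev_real_subset[OF v m(2)] Vm[OF vs] Vm[OF vE_in(2)]
        by (intro sobolev_norm_add sobolev_diff)
      moreover have "C * ?Y = 2 * (C2 * ?Y) + 2 * (8 * D1 * C3 * (C4 + 1) * C2 * ?Y)"
        by (simp add: C_def algebra_simps)
      ultimately show ?thesis
        using approx(1)[OF m] by simp
    qed
    then show ?thesis using vE_in(1) by blast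
  qed
  ultimately show ?thesis by blast
qed

end
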